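(* For every integer $d \geq 1$ there exists a constant $c_d > 0$, depending only on $d$, such that the following holds. Let $R > 0$ and let $\mu$ be a (nonnegative Borel) measure on $\mathbb{R}^d$ such that (1) $\mu$ is compactly supported in the ball $\{x \in \mathbb{R}^d : \|x\| \leq R\}$ of radius $R$ around the origin, and (2) $\mu$ is absolutely continuous with respect to Lebesgue measure and $\mu \leq dx$. Then, for all Lipschitz functions $f:\mathbb{R}^d \rightarrow \mathbb{R}$ such that $f(0)=0$, we have $$ \left| \int_{\mathbb{R}^d} f(x)\, d\mu(x) \right| \leq c_d\cdot R \cdot \mu(\mathbb{R}^d)^{\frac{d-1}{d}} \cdot \left\| \nabla f\right\|_{L^{d, 1}(\|x\| \leq R)}. $$
   Context: $\|\cdot\|$ is the Euclidean norm and $dx$ is Lebesgue measure on $\mathbb{R}^d$; $\mu \leq dx$ means $\mu(A) \leq |A|$ for every Borel set $A$, where $|A|$ is the Lebesgue measure of $A$ (equivalently, the density of $\mu$ is at most $1$ almost everywhere). For a measurable set $X \subset \mathbb{R}^d$ and a measurable (scalar- or vector-valued) function $h$ on $X$, the Lorentz norm is $$ \|h\|_{L^{d,1}(X)} = d \cdot \int_{0}^{\infty} \left| \left\{ x \in X: \|h(x)\| \geq t \right\}\right|^{\frac{1}{d}} dt, $$ and $L^{d,1}(\|x\| \leq R)$ means $X = \{x \in \mathbb{R}^d: \|x\| \leq R\}$. *)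

theory Defs
  imports "HOL-Analysis.Analysis"
begin

definition measure_support :: "'a::topological_space measure \<Rightarrow> 'a set" where
  "measure_support M = {x. \<forall>U. open U \<longrightarrow> x \<in> U \<longrightarrow> emeasure M U > 0}"

(* The value 0 at points of non-differentiability is a convention; for a Lipschitz
   function on a Euclidean space these points form a null set (Rademacher). *)
definition grad :: "('a::real_inner \<Rightarrow> real) \<Rightarrow> 'a \<Rightarrow> 'a" where
  "grad f x = (if \<exists>D. GDERIV f x :> D then (THE D. GDERIV f x :> D) else 0)"

definition ennreal_root :: "nat \<Rightarrow> ennreal \<Rightarrow> ennreal" where
  "ennreal_root n x = (if x = \<infinity> then \<infinity> else ennreal (root n (enn2real x)))"

(* The norm of L^{d,1}(X), where d = DIM('a) is the dimension of the ambient space. It takes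
   values in [0, \<infinity>]; the completed measure is used so that Lebesgue measurable X and h
   are covered. *)
definition lorentz_d1_norm ::
    "'a::euclidean_space set \<Rightarrow> ('a \<Rightarrow> 'b::real_normed_vector) \<Rightarrow> ennreal" where
  "lorentz_d1_norm X h =
     of_nat DIM('a) *
     (\<integral>\<^sup>+t\<in>{0..}. ennreal_root DIM('a) (emeasure lebesgue {x \<in> X. norm (h x) \<ge> t}) \<partial>lborel)"

end

theory Submission
  imports Defs
begin

text \<open>
  A Lipschitz function is differentiable almost everywhere (\<open>rademacher\<close>), and for almost every
  \<open>x\<close> almost every point of the segment from \<open>0\<close> to \<open>x\<close> is a point of differentiability. Along such a
  segment \<open>f\<close> is the integral of its derivative, so \<open>f 0 = 0\<close> gives
  \<open>\<bar>f x\<bar> \<le> \<integral>\<^sub>0\<^sup>1 \<parallel>x\<parallel> \<parallel>\<nabla>f (s x)\<parallel> ds\<close> (\<open>AE_le_radial_integral\<close>).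

  Integrate this against \<open>\<mu>\<close> and write \<open>\<parallel>\<nabla>f\<parallel>\<close> on the ball as the superposition over \<open>t \<ge> 0\<close> of the
  indicators of its superlevel sets \<open>E\<^sub>t\<close>. As the Lorentz norm is itself an integral over \<open>t\<close> of
  \<open>\<bar>E\<^sub>t\<bar>\<close> to the power \<open>1/d\<close>, it is enough to bound the contribution of a single Borel set \<open>E\<close>: with
  \<open>m = \<mu>(\<real>\<^sup>d)\<close>,
  \<open>\<integral>\<^sub>0\<^sup>1 \<integral> \<parallel>x\<parallel> 1\<^sub>E (s x) d\<mu>(x) ds \<le> 2 R m powr ((d-1)/d) \<bar>E\<bar> powr (1/d)\<close>
  (\<open>radial_kernel_bound\<close>). Here \<open>\<parallel>x\<parallel> \<le> R\<close>, and \<open>\<mu> {x. s x \<in> E}\<close> is at most \<open>m\<close> and, because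
  \<open>\<mu> \<le> dx\<close>, at most \<open>\<bar>E\<bar> / s\<^sup>d\<close>. Using the first bound below the crossing point
  \<open>s = (\<bar>E\<bar>/m) powr (1/d)\<close> and the second above it gives the claim when \<open>d \<ge> 2\<close>. For \<open>d = 1\<close> the
  tail of \<open>\<bar>E\<bar>/s\<close> would cost a logarithm; there the factor \<open>\<parallel>x\<parallel>\<close> is kept, and the substitution
  \<open>y = s x\<close> bounds the left-hand side by \<open>R \<bar>E\<bar>\<close>.

  Differentiability almost everywhere is obtained in three stages. On the line, a Lipschitz function
  plus a steep linear function is bi-Lipschitz, so it transports Lebesgue measure to an absolutely
  continuous measure, whose density is the derivative by the Lebesgue differentiation theorem. Fubini
  then gives directional derivatives almost everywhere in each fixed direction. These are linear in
  the direction almost everywhere, because their integrals over boxes are. Countably many directions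
  suffice, since the difference quotients of a Lipschitz function depend on the direction in a
  uniformly Lipschitz way.
\<close>

section \<open>Lipschitz functions on the line\<close>

text \<open>
  Adding \<open>(L + 1) x\<close> to \<open>f\<close> makes it a bi-Lipschitz bijection \<open>H\<close> of the line. The measure
  \<open>A \<mapsto> \<bar>H ` A\<bar>\<close> is absolutely continuous because Lipschitz maps preserve null sets, so it has a
  density \<open>h\<close>, and \<open>H b - H a\<close> is the integral of \<open>h\<close> over \<open>[a, b]\<close>. Averages of \<open>h\<close> over shrinking
  intervals converge to \<open>h\<close> almost everywhere, which says that \<open>h\<close> is the derivative of \<open>H\<close>.
\<close>

lemma lipschitz_real_has_derivative_AE:
  fixes f :: "real \<Rightarrow> real"
  assumes lip: "L-lipschitz_on UNIV f"
  obtains g where "AE t in lborel. (f has_real_derivative g t) (at t)"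
    and "\<And>a b. a \<le> b \<Longrightarrow> (g has_integral (f b - f a)) {a..b}"
proof -
  have fL: "\<bar>f x - f y\<bar> \<le> L * \<bar>x - y\<bar>" for x y
    using lipschitz_onD[OF lip, of x y] by (simp add: dist_real_def)
  have L0: "L \<ge> 0" using lip lipschitz_on_nonneg by blast
  define H where "H x = f x + (L + 1) * x" for x
  have H_exp: "y - x \<le> H y - H x" if "x \<le> y" for x y
    using fL[of y x] that by (auto simp: H_def abs_le_iff algebra_simps)
  have H_abs: "\<bar>x - y\<bar> \<le> \<bar>H x - H y\<bar>" for x y
    using H_exp[of x y] H_exp[of y x] by linarith
  have H_lip: "\<bar>H x - H y\<bar> \<le> (2 * L + 1) * \<bar>x - y\<bar>" for x y
  proof -
    have "H x - H y = (f x - f y) + (L + 1) * (x - y)" by (simp add: H_def algebra_simps)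
    also have "\<bar>\<dots>\<bar> \<le> \<bar>f x - f y\<bar> + (L + 1) * \<bar>x - y\<bar>"
      using L0 abs_triangle_ineq[of "f x - f y" "(L + 1) * (x - y)"] by (simp add: abs_mult)
    also have "\<dots> \<le> (2 * L + 1) * \<bar>x - y\<bar>" using fL[of x y] by (simp add: algebra_simps)
    finally show ?thesis .
  qed
  have H_inj: "inj H"
    using H_abs by (auto simp: inj_def) (metis abs_le_zero_iff eq_iff_diff_eq_0 abs_zero)
  have H_cont: "continuous_on UNIV H"
    unfolding H_def by (intro continuous_intros lipschitz_on_continuous_on[OF lip])
  have H_surj: "surj H"
  proof -
    have "\<exists>x. H x = y" for y
    proof -
      define n where "n = \<bar>y - H 0\<bar>"
      have "H (- n) \<le> y" "y \<le> H n" "- n \<le> n"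
        using H_exp[of "-n" 0] H_exp[of 0 n] by (auto simp: n_def)
      then show ?thesis
        using IVT'[of H "-n" y n] continuous_on_subset[OF H_cont, of "{-n..n}"] by auto
    qed
    then show ?thesis by (metis surjI)
  qed
  define K where "K = inv H"
  have HK: "H (K y) = y" for y unfolding K_def using H_surj by (rule surj_f_inv_f)
  have KH: "K (H x) = x" for x unfolding K_def using H_inj by (rule inv_f_f)
  have "1-lipschitz_on UNIV K"
    using H_abs[of "K x" "K y" for x y] by (intro lipschitz_onI) (auto simp: HK dist_real_def)
  then have K_meas [measurable]: "K \<in> borel_measurable borel"
    by (intro borel_measurable_continuous_onI lipschitz_on_continuous_on)
  have H_less: "H x \<le> H y \<longleftrightarrow> x \<le> y" for x y
    using H_exp[of x y] H_exp[of y x] by linarith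
  \<comment> \<open>Pushing forward along the inverse of \<open>H\<close> turns \<open>\<bar>H ` A\<bar>\<close> into a measure in \<open>A\<close>.\<close>
  define \<nu> where "\<nu> = distr lborel borel K"
  have \<nu>_Icc: "emeasure \<nu> {a..b} = ennreal (H b - H a)" if "a \<le> b" for a b
  proof -
    have "K -` {a..b} = {H a..H b}"
      using H_less HK by auto metis+
    then show ?thesis
      using that H_less[of a b] by (simp add: \<nu>_def emeasure_distr)
  qed
  have "absolutely_continuous lborel \<nu>"
    unfolding absolutely_continuous_def
  proof
    fix A :: "real set" assume A: "A \<in> null_sets lborel"
    then have "negligible A"
      by (simp add: negligible_iff_null_sets null_sets_completionI)
    then have "negligible (H ` A)"
      by (rule negligible_locally_Lipschitz_image[rotated])
        (use H_lip in \<open>auto intro!: exI[of _ UNIV] exI[of _ "2 * L + 1"]\<close>)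
    moreover have "H ` A = K -` A" using HK KH by (auto simp: image_iff) metis
    ultimately have "K -` A \<in> null_sets lborel"
      using A measurable_sets[OF K_meas, of A]
      by (auto simp: negligible_iff_null_sets null_sets_completion_iff null_sets_def)
    then show "A \<in> null_sets \<nu>"
      using A by (auto simp: \<nu>_def null_sets_def emeasure_distr)
  qed
  then obtain h0 where h0 [measurable]: "h0 \<in> borel_measurable borel" and dens: "density lborel h0 = \<nu>"
    using sigma_finite_measure.Radon_Nikodym[OF sigma_finite_lborel, of \<nu>] by (auto simp: \<nu>_def)
  have h0_int: "(\<integral>\<^sup>+x. h0 x * indicator {a..b} x \<partial>lborel) = ennreal (H b - H a)" if "a \<le> b" for a b
    using \<nu>_Icc[OF that] by (simp add: dens[symmetric] emeasure_density)
  have "AE x in lborel. \<forall>n::nat. h0 x * indicator {- real n..real n} x \<noteq> \<infinity>"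
    unfolding AE_all_countable by (intro allI nn_integral_PInf_AE) (auto simp: h0_int)
  then have h0_fin: "AE x in lborel. h0 x \<noteq> \<infinity>"
  proof eventually_elim
    case (elim x)
    obtain n :: nat where "\<bar>x\<bar> \<le> real n" using real_arch_simple by blast
    then have "indicator {- real n..real n} x = (1 :: ennreal)" by (auto simp: indicator_def)
    then show ?case using elim[rule_format, of n] by simp
  qed
  define h where "h x = enn2real (h0 x)" for x
  have h_meas [measurable]: "h \<in> borel_measurable borel" unfolding h_def by simp
  have h_int: "(h has_integral (H b - H a)) {a..b}" if ab: "a \<le> b" for a b
  proof -
    have "(\<integral>\<^sup>+x. ennreal (h x * indicator {a..b} x) \<partial>lborel) = (\<integral>\<^sup>+x. h0 x * indicator {a..b} x \<partial>lborel)"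
      by (rule nn_integral_cong_AE) (use h0_fin in \<open>eventually_elim, auto simp: h_def indicator_def top.not_eq_extremum\<close>)
    then have "((\<lambda>x. h x * indicator {a..b} x) has_integral (H b - H a)) UNIV"
      using ab h0_int[OF ab] H_less[of a b] by (intro nn_integral_has_integral) (auto simp: h_def)
    moreover have "(\<lambda>x. h x * indicator {a..b} x) = (\<lambda>x. if x \<in> {a..b} then h x else 0)"
      by (auto simp: indicator_def)
    ultimately show ?thesis
      by (simp only: has_integral_restrict_UNIV)
  qed
  \<comment> \<open>The differentiation theorem concerns averages over \<open>[x, x + t]\<close>, hence right difference
    quotients. It is applied a second time to the reflected function for the left ones, where it
    yields the same density \<open>h\<close>, so that the one-sided derivatives agree.\<close>
  have right: "\<exists>N. negligible N \<and> (\<forall>x. x \<notin> N \<longrightarrow> ((\<lambda>t. (P (x + t) - P x) / t) \<longlongrightarrow> p x) (at_right 0))"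
    if P: "\<And>a b. a \<le> b \<Longrightarrow> (p has_integral (P b - P a)) {a..b}" for p P :: "real \<Rightarrow> real"
  proof -
    have "p integrable_on cbox a b" for a b
      using P[of a b] by (cases "a \<le> b") (auto simp: integrable_on_def)
    then obtain N where "negligible N" and N: "\<And>x e. \<lbrakk>x \<notin> N; 0 < e\<rbrakk> \<Longrightarrow>
               \<exists>d>0. \<forall>t. 0 < t \<and> t < d \<longrightarrow>
                         norm(integral (cbox x (x + t *\<^sub>R One)) p /\<^sub>R t ^ DIM(real) - p x) < e"
      using integrable_ccontinuous_explicit by blast
    have "((\<lambda>t. (P (x + t) - P x) / t) \<longlongrightarrow> p x) (at_right 0)" if "x \<notin> N" for x
    proof (rule tendstoI)
      fix e :: real assume "e > 0"
      from N[OF that this] obtain d where "d > 0" and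
        d: "\<And>t. 0 < t \<Longrightarrow> t < d \<Longrightarrow> norm(integral (cbox x (x + t *\<^sub>R One)) p /\<^sub>R t ^ DIM(real) - p x) < e"
        by blast
      have "dist ((P (x + t) - P x) / t) (p x) < e" if "0 < t" "t < d" for t
        using d[OF that] integral_unique[OF P[of x "x + t"]] that by (simp add: dist_real_def divide_inverse_commute)
      then show "\<forall>\<^sub>F t in at_right 0. dist ((P (x + t) - P x) / t) (p x) < e"
        using \<open>d > 0\<close> by (auto simp: eventually_at_right_field)
    qed
    with \<open>negligible N\<close> show ?thesis by blast
  qed
  obtain N1 where N1: "negligible N1" "\<And>x. x \<notin> N1 \<Longrightarrow> ((\<lambda>t. (H (x + t) - H x) / t) \<longlongrightarrow> h x) (at_right 0)"
    using right[OF h_int] by blast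
  have "((\<lambda>x. h (- x)) has_integral (- H (- b) - - H (- a))) {a..b}" if "a \<le> b" for a b
    using h_int[of "-b" "-a"] that has_integral_reflect_real[where f = h and a = "- b" and b = "- a"] by simp
  from right[of "\<lambda>x. h (- x)" "\<lambda>x. - H (- x)", OF this]
  obtain N2 where N2: "negligible N2"
    "\<And>x. x \<notin> N2 \<Longrightarrow> ((\<lambda>t. (- H (- (x + t)) - - H (- x)) / t) \<longlongrightarrow> h (- x)) (at_right 0)"
    by blast
  have H_deriv: "(H has_real_derivative h x) (at x)" if "x \<notin> N1" "- x \<notin> N2" for x
  proof -
    have "((\<lambda>t. (- H (- (- x + t)) - - H (- (- x))) / t) \<longlongrightarrow> h (- (- x))) (at_right 0)"
      using N2(2)[OF that(2)] .
    moreover have "(\<lambda>t. (- H (- (- x + t)) - - H (- (- x))) / t) = (\<lambda>t. (H (x + - t) - H x) / - t)"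
      by (rule ext) (simp add: divide_simps)
    ultimately have "((\<lambda>t. (H (x + t) - H x) / t) \<longlongrightarrow> h x) (at_left 0)"
      by (simp add: filterlim_at_left_to_right)
    then have "((\<lambda>t. (H (x + t) - H x) / t) \<longlongrightarrow> h x) (at 0)"
      using N1(2)[OF that(1)] by (simp add: filterlim_split_at)
    then show ?thesis by (simp add: DERIV_def)
  qed
  define g where "g x = h x - (L + 1)" for x
  have f_eq: "f = (\<lambda>x. H x - (L + 1) * x)" by (auto simp: H_def)
  show thesis
  proof (rule that[of g])
    have "negligible (N1 \<union> uminus ` N2)"
      using N1(1) N2(1)
      by (intro negligible_Un negligible_locally_Lipschitz_image[of N2])
        (auto intro!: exI[of _ "UNIV :: real set"] exI[of _ "1 :: real"])
    then have "AE x in completion lborel. x \<notin> N1 \<union> uminus ` N2"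
      by (intro AE_not_in) (simp add: negligible_iff_null_sets)
    then have "AE x in lborel. x \<notin> N1 \<union> uminus ` N2"
      by (simp only: AE_completion_iff)
    then show "AE x in lborel. (f has_real_derivative g x) (at x)"
    proof eventually_elim
      case (elim x)
      then have "- x \<notin> N2" by (metis UnI2 image_eqI minus_minus)
      with elim have "(H has_real_derivative h x) (at x)" using H_deriv by blast
      then show ?case unfolding f_eq g_def by (auto intro!: derivative_eq_intros)
    qed
    show "(g has_integral (f b - f a)) {a..b}" if "a \<le> b" for a b
    proof -
      have "((\<lambda>x. L + 1) has_integral (b - a) * (L + 1)) {a..b}"
        using has_integral_const_real[of "L + 1" a b] that by simp
      then have "(g has_integral ((H b - H a) - (b - a) * (L + 1))) {a..b}"
        unfolding g_def by (intro has_integral_diff h_int that)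
      then show ?thesis using that by (simp add: H_def algebra_simps)
    qed
  qed
qed

section \<open>Directional derivatives\<close>

definition diffquot :: "('a::real_vector \<Rightarrow> real) \<Rightarrow> 'a \<Rightarrow> nat \<Rightarrow> 'a \<Rightarrow> real" where
  "diffquot f v n x = real (Suc n) * (f (x + (1 / real (Suc n)) *\<^sub>R v) - f x)"

text \<open>
  A limit along the sequence of step sizes \<open>1 / (n + 1)\<close> instead of a limit in a real parameter: this
  makes \<open>dirderiv f v\<close> a Borel function on the whole space for continuous \<open>f\<close>. At points where the
  sequence diverges the value is arbitrary.
\<close>

definition dirderiv :: "('a::real_vector \<Rightarrow> real) \<Rightarrow> 'a \<Rightarrow> 'a \<Rightarrow> real" where
  "dirderiv f v x = lim (\<lambda>n. diffquot f v n x)"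

definition has_dirderiv :: "('a::real_vector \<Rightarrow> real) \<Rightarrow> real \<Rightarrow> 'a \<Rightarrow> 'a \<Rightarrow> bool" where
  "has_dirderiv f D v x \<longleftrightarrow> ((\<lambda>t. (f (x + t *\<^sub>R v) - f x) / t) \<longlongrightarrow> D) (at 0)"

lemma has_dirderiv_imp_diffquot:
  assumes "has_dirderiv f D v x"
  shows "(\<lambda>n. diffquot f v n x) \<longlonglongrightarrow> D"
proof -
  have "filterlim (\<lambda>n. 1 / real (Suc n)) (at 0) sequentially"
    using LIMSEQ_inverse_real_of_nat by (auto simp: filterlim_at inverse_eq_divide)
  from filterlim_compose[OF assms[unfolded has_dirderiv_def] this] show ?thesis
    by (simp add: diffquot_def mult.commute)
qed

lemma has_dirderiv_imp_dirderiv_eq: "has_dirderiv f D v x \<Longrightarrow> dirderiv f v x = D"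
  using has_dirderiv_imp_diffquot limI unfolding dirderiv_def by blast

lemma has_dirderiv_scaleR:
  assumes "has_dirderiv f D v x"
  shows "has_dirderiv f (c * D) (c *\<^sub>R v) x"
proof (cases "c = 0")
  case False
  have "filterlim (\<lambda>t::real. c * t) (at 0) (at 0)"
    using False by (auto simp: filterlim_at eventually_at_filter intro!: tendsto_eq_intros)
  from filterlim_compose[OF assms[unfolded has_dirderiv_def] this]
  have "((\<lambda>t. c * ((f (x + (c * t) *\<^sub>R v) - f x) / (c * t))) \<longlongrightarrow> c * D) (at 0)"
    by (rule tendsto_mult_left)
  then show ?thesis
    using False unfolding has_dirderiv_def by (simp add: mult.commute[of c])
qed (simp add: has_dirderiv_def)

text \<open>
  Averages over shrinking boxes recover the function almost everywhere.
\<close>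

lemma AE_eq_0_if_integral_cbox_eq_0:
  fixes k :: "'a::euclidean_space \<Rightarrow> real"
  assumes "\<And>a b. (k has_integral 0) (cbox a b)"
  shows "AE x in lborel. k x = 0"
proof -
  have "k integrable_on cbox a b" for a b using assms by blast
  then obtain N where "negligible N" and N: "\<And>x e. \<lbrakk>x \<notin> N; 0 < e\<rbrakk> \<Longrightarrow>
               \<exists>d>0. \<forall>h. 0 < h \<and> h < d \<longrightarrow>
                         norm(integral (cbox x (x + h *\<^sub>R One)) k /\<^sub>R h ^ DIM('a) - k x) < e"
    using integrable_ccontinuous_explicit by blast
  have "k x = 0" if "x \<notin> N" for x
  proof (rule ccontr)
    assume "k x \<noteq> 0"
    then have "\<bar>k x\<bar> > 0" by simp
    from N[OF that this] obtain d where "d > 0" and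
      d: "\<And>h. 0 < h \<Longrightarrow> h < d \<Longrightarrow> norm(integral (cbox x (x + h *\<^sub>R One)) k /\<^sub>R h ^ DIM('a) - k x) < \<bar>k x\<bar>"
      by blast
    show False using d[of "d/2"] \<open>d > 0\<close> integral_unique[OF assms] by simp
  qed
  moreover have "AE x in completion lborel. x \<notin> N"
    using \<open>negligible N\<close> by (intro AE_not_in) (simp add: negligible_iff_null_sets)
  ultimately have "AE x in completion lborel. k x = 0" by (auto elim: eventually_mono)
  then show ?thesis by (simp only: AE_completion_iff)
qed

locale lipschitz_function =
  fixes f :: "'a::euclidean_space \<Rightarrow> real" and L :: real
  assumes lip: "L-lipschitz_on UNIV f"
begin

lemma lip_bound: "\<bar>f x - f y\<bar> \<le> L * norm (x - y)"
  using lipschitz_onD[OF lip, of x y] by (simp add: dist_norm)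

lemma L_nonneg: "L \<ge> 0"
  using lip lipschitz_on_nonneg by blast

lemma continuous_f: "continuous_on S f"
  using lipschitz_on_continuous_on[OF lip] continuous_on_subset by blast

lemma f_measurable [measurable]: "f \<in> borel_measurable borel"
  by (intro borel_measurable_continuous_onI continuous_f)

lemma diffquot_measurable [measurable]: "diffquot f v n \<in> borel_measurable borel"
  unfolding diffquot_def by measurable

lemma dirderiv_measurable [measurable]: "dirderiv f v \<in> borel_measurable borel"
  unfolding dirderiv_def by measurable

lemma diffquot_bound: "\<bar>diffquot f v n x\<bar> \<le> L * norm v"
proof -
  have "\<bar>diffquot f v n x\<bar> \<le> real (Suc n) * (L * norm ((1 / real (Suc n)) *\<^sub>R v))"
    using lip_bound[of "x + (1 / real (Suc n)) *\<^sub>R v" x]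
    unfolding diffquot_def abs_mult by (intro mult_mono) auto
  then show ?thesis by simp
qed

text \<open>
  By continuity of \<open>f\<close> rational step sizes suffice to test the existence of a directional derivative.
  All quantifiers then range over countable sets, which makes the set of good points Borel
  (\<open>has_dirderiv_measurable\<close>), as Fubini requires.
\<close>

lemma has_dirderiv_iff_rational:
  "has_dirderiv f D v x \<longleftrightarrow>
    (\<forall>k::nat. \<exists>m::nat. \<forall>t\<in>\<rat>. 0 < \<bar>t\<bar> \<and> \<bar>t\<bar> < 1 / real (Suc m) \<longrightarrow>
       \<bar>f (x + t *\<^sub>R v) - f x - t * D\<bar> \<le> \<bar>t\<bar> / real (Suc k))" (is "_ \<longleftrightarrow> ?R")
proof
  assume lim: "has_dirderiv f D v x"
  show ?R
  proof
    fix k :: nat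
    have "1 / real (Suc k) > 0" by simp
    from tendstoD[OF lim[unfolded has_dirderiv_def] this]
    obtain d where "d > 0" and
      d: "\<And>t. t \<noteq> 0 \<Longrightarrow> \<bar>t\<bar> < d \<Longrightarrow> \<bar>(f (x + t *\<^sub>R v) - f x) / t - D\<bar> < 1 / real (Suc k)"
      by (auto simp: eventually_at dist_real_def)
    obtain m :: nat where m: "1 / real (Suc m) < d"
      using \<open>d > 0\<close> nat_approx_posE by blast
    have "\<bar>f (x + t *\<^sub>R v) - f x - t * D\<bar> \<le> \<bar>t\<bar> / real (Suc k)"
      if "0 < \<bar>t\<bar>" "\<bar>t\<bar> < 1 / real (Suc m)" for t
    proof -
      have "f (x + t *\<^sub>R v) - f x - t * D = t * ((f (x + t *\<^sub>R v) - f x) / t - D)"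
        using that by (simp add: field_simps)
      also have "\<bar>\<dots>\<bar> \<le> \<bar>t\<bar> * (1 / real (Suc k))"
        unfolding abs_mult using d[of t] that m by (intro mult_left_mono) auto
      finally show ?thesis by simp
    qed
    then show "\<exists>m::nat. \<forall>t\<in>\<rat>. 0 < \<bar>t\<bar> \<and> \<bar>t\<bar> < 1 / real (Suc m) \<longrightarrow>
       \<bar>f (x + t *\<^sub>R v) - f x - t * D\<bar> \<le> \<bar>t\<bar> / real (Suc k)" by blast
  qed
next
  assume R: ?R
  show "has_dirderiv f D v x"
    unfolding has_dirderiv_def
  proof (rule tendstoI)
    fix e :: real assume "e > 0"
    then obtain k :: nat where k: "1 / real (Suc k) < e" using nat_approx_posE by blast
    from R obtain m :: nat where m: "\<And>t. t \<in> \<rat> \<Longrightarrow> 0 < \<bar>t\<bar> \<Longrightarrow> \<bar>t\<bar> < 1 / real (Suc m) \<Longrightarrow>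
       \<bar>f (x + t *\<^sub>R v) - f x - t * D\<bar> \<le> \<bar>t\<bar> / real (Suc k)" by blast
    define U where "U = {t::real. 0 < \<bar>t\<bar> \<and> \<bar>t\<bar> < 1 / real (Suc m)}"
    define C where "C = {t. \<bar>f (x + t *\<^sub>R v) - f x - t * D\<bar> \<le> \<bar>t\<bar> / real (Suc k)}"
    have "open U" unfolding U_def
      by (intro open_Collect_conj open_Collect_less continuous_intros)
    have "closed C" unfolding C_def
      by (intro closed_Collect_le continuous_intros continuous_on_compose2[OF continuous_f]) auto
    have "U \<inter> \<rat> \<subseteq> C" using m by (auto simp: U_def C_def)
    have "U \<subseteq> closure (U \<inter> \<rat>)"
      using open_Int_closure_subset[OF \<open>open U\<close>, of \<rat>] by (simp add: Rats_closure_real)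
    also have "\<dots> \<subseteq> C"
      using closure_mono[OF \<open>U \<inter> \<rat> \<subseteq> C\<close>] closure_closed[OF \<open>closed C\<close>] by simp
    finally have "U \<subseteq> C" .
    have "dist ((f (x + t *\<^sub>R v) - f x) / t) D < e" if "t \<noteq> 0" "\<bar>t\<bar> < 1 / real (Suc m)" for t
    proof -
      have "\<bar>f (x + t *\<^sub>R v) - f x - t * D\<bar> \<le> \<bar>t\<bar> * (1 / real (Suc k))"
        using \<open>U \<subseteq> C\<close> that by (auto simp: U_def C_def)
      moreover have "f (x + t *\<^sub>R v) - f x - t * D = t * ((f (x + t *\<^sub>R v) - f x) / t - D)"
        using that by (simp add: field_simps)
      ultimately have "\<bar>(f (x + t *\<^sub>R v) - f x) / t - D\<bar> \<le> 1 / real (Suc k)"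
        using that by (metis abs_mult mult_le_cancel_left_pos zero_less_abs_iff)
      then show ?thesis using k by (simp add: dist_real_def)
    qed
    then show "\<forall>\<^sub>F t in at 0. dist ((f (x + t *\<^sub>R v) - f x) / t) D < e"
      unfolding eventually_at by (intro exI[of _ "1 / real (Suc m)"]) (auto simp: dist_real_def)
  qed
qed

lemma has_dirderiv_measurable [measurable]:
  "Measurable.pred borel (\<lambda>x. has_dirderiv f (dirderiv f v x) v x)"
proof -
  note [measurable] = countable_rat
  show ?thesis unfolding has_dirderiv_iff_rational by measurable
qed

text \<open>
  On each line parallel to \<open>v\<close> the restriction of \<open>f\<close> is Lipschitz, so almost every point of the line is
  good. Parametrising by \<open>x + t v\<close> and exchanging quantifiers, some single \<open>t\<close> makes \<open>x + t v\<close> good for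
  almost every \<open>x\<close>; translation invariance removes \<open>t\<close>. This covers every direction without
  rotating coordinates.
\<close>

lemma AE_has_dirderiv: "AE x in lborel. has_dirderiv f (dirderiv f v x) v x"
proof -
  let ?P = "\<lambda>x. has_dirderiv f (dirderiv f v x) v x"
  have line: "AE t in lborel. ?P (x + t *\<^sub>R v)" for x
  proof -
    have "(L * norm v)-lipschitz_on UNIV (\<lambda>t. f (x + t *\<^sub>R v))"
    proof (rule lipschitz_onI)
      fix s t :: real
      show "dist (f (x + s *\<^sub>R v)) (f (x + t *\<^sub>R v)) \<le> L * norm v * dist s t"
        using lip_bound[of "x + s *\<^sub>R v" "x + t *\<^sub>R v"]
        by (simp add: dist_real_def scaleR_left_diff_distrib[symmetric] mult_ac)
    qed (use L_nonneg in simp)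
    then obtain g where "AE t in lborel. ((\<lambda>t. f (x + t *\<^sub>R v)) has_real_derivative g t) (at t)"
      by (rule lipschitz_real_has_derivative_AE)
    then show ?thesis
    proof eventually_elim
      case (elim t)
      then have "has_dirderiv f (g t) v (x + t *\<^sub>R v)"
        by (simp add: DERIV_def has_dirderiv_def scaleR_left_distrib add.assoc)
      then show ?case using has_dirderiv_imp_dirderiv_eq by metis
    qed
  qed
  have pair: "pair_sigma_finite (lborel :: 'a measure) (lborel :: real measure)"
    by (intro pair_sigma_finite.intro sigma_finite_lborel)
  have "(\<lambda>z. fst z + snd z *\<^sub>R v) \<in> borel_measurable ((lborel :: 'a measure) \<Otimes>\<^sub>M (lborel :: real measure))"
    by measurable
  from measurable_compose[OF this has_dirderiv_measurable]
  have "{z \<in> space ((lborel :: 'a measure) \<Otimes>\<^sub>M (lborel :: real measure)). ?P (fst z + snd z *\<^sub>R v)}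
      \<in> sets (lborel \<Otimes>\<^sub>M lborel)"
    by (simp only: pred_def)
  then have "AE t in lborel. AE x in lborel. ?P (x + t *\<^sub>R v)"
    using line by (subst pair_sigma_finite.AE_commute[OF pair, symmetric]) auto
  moreover have "ae_filter (lborel :: real measure) \<noteq> bot"
    by (simp add: ae_filter_eq_bot_iff)
  ultimately obtain t where "AE x in lborel. ?P (x + t *\<^sub>R v)"
    using eventually_happens' by blast
  then have "AE x in lborel. ?P (t *\<^sub>R v + x)" by (simp add: add.commute)
  then have "AE x in distr lborel borel ((+) (t *\<^sub>R v)). ?P x"
    by (subst AE_distr_iff) auto
  then show ?thesis by (simp only: lborel_distr_plus)
qed

lemma dirderiv_bound: "AE x in lborel. \<bar>dirderiv f v x\<bar> \<le> L * norm v"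
  using AE_has_dirderiv[of v]
proof eventually_elim
  case (elim x)
  from has_dirderiv_imp_diffquot[OF this] show ?case
    by (intro tendsto_upperbound[OF tendsto_rabs]) (auto simp: diffquot_bound)
qed

section \<open>Rademacher's theorem\<close>

lemma diffquot_integrable:
  assumes "A \<in> sets borel" "bounded A"
  shows "integrable lborel (\<lambda>x. indicator A x * diffquot f v n x)"
proof (rule Bochner_Integration.integrable_bound)
  show "integrable lborel (\<lambda>x. indicator A x * (L * norm v))"
    using assms emeasure_bounded_finite[of A] by auto
  show "AE x in lborel. norm (indicator A x * diffquot f v n x) \<le> norm (indicator A x * (L * norm v))"
    using diffquot_bound L_nonneg by (auto simp: indicator_def)
  note [measurable] = assms(1)
  show "(\<lambda>x. indicator A x * diffquot f v n x) \<in> borel_measurable lborel" by measurable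
qed

lemma dirderiv_integrable:
  assumes "A \<in> sets borel" "bounded A"
  shows "integrable lborel (\<lambda>x. indicator A x * dirderiv f v x)"
proof (rule Bochner_Integration.integrable_bound)
  show "integrable lborel (\<lambda>x. indicator A x * (L * norm v))"
    using assms emeasure_bounded_finite[of A] by auto
  show "AE x in lborel. norm (indicator A x * dirderiv f v x) \<le> norm (indicator A x * (L * norm v))"
    using dirderiv_bound[of v] by eventually_elim (use L_nonneg in \<open>auto simp: indicator_def\<close>)
  note [measurable] = assms(1)
  show "(\<lambda>x. indicator A x * dirderiv f v x) \<in> borel_measurable lborel" by measurable
qed

text \<open>
  Dominated convergence: the translated boxes converge to \<open>cbox a b\<close> off its boundary, a null set.
\<close>

lemma integral_moving_box_diffquot_tendsto:
  fixes a b u v :: 'a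
  shows "(\<lambda>n. \<integral>y. indicator (cbox a b) (y - (1 / real (Suc n)) *\<^sub>R u) * diffquot f v n y \<partial>lborel)
     \<longlonglongrightarrow> (\<integral>y. indicator (cbox a b) y * dirderiv f v y \<partial>lborel)"
proof -
  obtain C where C: "\<And>x. x \<in> cbox a b \<Longrightarrow> norm x \<le> C"
    using bounded_cbox[of a b] by (auto simp: bounded_iff)
  define B :: "'a set" where "B = cball 0 (C + norm u)"
  have shift: "(\<lambda>n. y - (1 / real (Suc n)) *\<^sub>R u) \<longlonglongrightarrow> y" for y
    using tendsto_diff[OF tendsto_const tendsto_scaleR[OF LIMSEQ_Suc[OF lim_1_over_n] tendsto_const], of y u]
    by simp
  show ?thesis
  proof (rule integral_dominated_convergence[where w = "\<lambda>y. indicator B y * (L * norm v)"])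
    have "emeasure lborel B < \<infinity>"
      unfolding B_def by (intro emeasure_bounded_finite) auto
    then show "integrable lborel (\<lambda>y. indicator B y * (L * norm v))"
      by (simp add: B_def)
    show "AE y in lborel. norm (indicator (cbox a b) (y - (1 / real (Suc n)) *\<^sub>R u) * diffquot f v n y)
        \<le> indicator B y * (L * norm v)" for n
    proof (rule AE_I2)
      fix y
      have "y \<in> B" if "y - (1 / real (Suc n)) *\<^sub>R u \<in> cbox a b"
      proof -
        have "norm y \<le> norm (y - (1 / real (Suc n)) *\<^sub>R u) + norm ((1 / real (Suc n)) *\<^sub>R u)"
          by (metis diff_add_cancel norm_triangle_ineq)
        also have "norm ((1 / real (Suc n)) *\<^sub>R u) \<le> norm u"
          by (simp add: divide_le_eq mult_le_cancel_left1)
        finally show ?thesis using C[OF that] by (simp add: B_def)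
      qed
      then show "norm (indicator (cbox a b) (y - (1 / real (Suc n)) *\<^sub>R u) * diffquot f v n y)
        \<le> indicator B y * (L * norm v)"
        using diffquot_bound[of v n y] L_nonneg by (auto simp: indicator_def)
    qed
    have "AE y in completion lborel. y \<notin> cbox a b - box a b"
      by (intro AE_not_in) (use negligible_frontier_interval[of a b] in \<open>simp add: negligible_iff_null_sets\<close>)
    then have "AE y in lborel. y \<notin> cbox a b - box a b" by (simp only: AE_completion_iff)
    then show "AE y in lborel. (\<lambda>n. indicator (cbox a b) (y - (1 / real (Suc n)) *\<^sub>R u) * diffquot f v n y)
        \<longlonglongrightarrow> indicator (cbox a b) y * dirderiv f v y"
      using AE_has_dirderiv[of v]
    proof eventually_elim
      case (elim y)
      have "\<forall>\<^sub>F n in sequentially. indicator (cbox a b) (y - (1 / real (Suc n)) *\<^sub>R u) = (indicator (cbox a b) y :: real)"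
      proof (cases "y \<in> box a b")
        case True
        then have "\<forall>\<^sub>F n in sequentially. y - (1 / real (Suc n)) *\<^sub>R u \<in> box a b"
          using topological_tendstoD[OF shift open_box] by blast
        then show ?thesis
          using True box_subset_cbox[of a b] by (auto elim!: eventually_mono simp: indicator_def)
      next
        case False
        then have "y \<in> - cbox a b" using elim by auto
        then have "\<forall>\<^sub>F n in sequentially. y - (1 / real (Suc n)) *\<^sub>R u \<in> - cbox a b"
          by (intro topological_tendstoD[OF shift]) auto
        then show ?thesis
          using \<open>y \<in> - cbox a b\<close> by (auto elim!: eventually_mono simp: indicator_def)
      qed
      then show ?case
        by (intro tendsto_mult tendsto_eventually has_dirderiv_imp_diffquot elim)
    qed
  qed measurable
qed

text \<open>
  The quotient in direction \<open>v + w\<close> splits into the quotient in direction \<open>v\<close> and the quotient in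
  direction \<open>w\<close> at the moved point \<open>x + v / (n + 1)\<close>. Integrated over a box, the move can be shifted
  from the integrand to the box, where it disappears in the limit. Hence both sides have the same
  integral over every box.
\<close>

lemma dirderiv_add: "AE x in lborel. dirderiv f (v + w) x = dirderiv f v x + dirderiv f w x"
proof -
  define k where "k x = dirderiv f (v + w) x - dirderiv f v x - dirderiv f w x" for x
  have "(k has_integral 0) (cbox a b)" for a b
  proof -
    let ?Q = "cbox a b"
    have I: "(\<lambda>n. \<integral>y. indicator ?Q y * diffquot f u n y \<partial>lborel)
       \<longlonglongrightarrow> (\<integral>y. indicator ?Q y * dirderiv f u y \<partial>lborel)" for u
      using integral_moving_box_diffquot_tendsto[of a b 0 u] by simp
    have split: "(\<integral>y. indicator ?Q y * diffquot f (v + w) n y \<partial>lborel) =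
        (\<integral>y. indicator ?Q y * diffquot f v n y \<partial>lborel) +
        (\<integral>y. indicator ?Q (y - (1 / real (Suc n)) *\<^sub>R v) * diffquot f w n y \<partial>lborel)" for n
    proof -
      let ?h = "(1 / real (Suc n)) *\<^sub>R v"
      have q: "diffquot f (v + w) n y = diffquot f v n y + diffquot f w n (?h + y)" for y
        by (simp add: diffquot_def algebra_simps)
      have m: "(\<lambda>y. indicator ?Q (y - ?h) * diffquot f w n y) \<in> borel_measurable borel" by measurable
      have "(\<integral>y. indicator ?Q (y - ?h) * diffquot f w n y \<partial>lborel) =
         (\<integral>y. indicator ?Q (y - ?h) * diffquot f w n y \<partial>distr lborel borel ((+) ?h))"
        by (simp only: lborel_distr_plus)
      also have "\<dots> = (\<integral>y. indicator ?Q y * diffquot f w n (?h + y) \<partial>lborel)"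
        by (subst integral_distr[OF _ m]) simp_all
      finally have eq: "(\<integral>y. indicator ?Q (y - ?h) * diffquot f w n y \<partial>lborel) =
        (\<integral>y. indicator ?Q y * diffquot f w n (?h + y) \<partial>lborel)" .
      have i1: "integrable lborel (\<lambda>y. indicator ?Q y * diffquot f u n y)" for u
        by (rule diffquot_integrable) auto
      have "integrable lborel (\<lambda>y. indicator ?Q y * diffquot f (v + w) n y - indicator ?Q y * diffquot f v n y)"
        by (intro Bochner_Integration.integrable_diff i1)
      then have i2: "integrable lborel (\<lambda>y. indicator ?Q y * diffquot f w n (?h + y))"
        by (simp add: q algebra_simps)
      show ?thesis unfolding eq
        by (subst Bochner_Integration.integral_add[symmetric, OF i1 i2]) (simp add: q distrib_left)
    qed
    have "(\<lambda>n. \<integral>y. indicator ?Q y * diffquot f (v + w) n y \<partial>lborel)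
       \<longlonglongrightarrow> (\<integral>y. indicator ?Q y * dirderiv f v y \<partial>lborel) + (\<integral>y. indicator ?Q y * dirderiv f w y \<partial>lborel)"
      unfolding split by (intro tendsto_add I integral_moving_box_diffquot_tendsto)
    from LIMSEQ_unique[OF I this]
    have eq: "(\<integral>y. indicator ?Q y * dirderiv f (v + w) y \<partial>lborel) =
       (\<integral>y. indicator ?Q y * dirderiv f v y \<partial>lborel) + (\<integral>y. indicator ?Q y * dirderiv f w y \<partial>lborel)" .
    have i: "integrable lborel (\<lambda>y. indicator ?Q y * dirderiv f u y)" for u
      by (rule dirderiv_integrable) auto
    have "((\<lambda>y. indicator ?Q y * dirderiv f (v + w) y - indicator ?Q y * dirderiv f v y - indicator ?Q y * dirderiv f w y)
       has_integral 0) UNIV"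
      using has_integral_diff[OF has_integral_diff[OF has_integral_integral_lborel[OF i[of "v + w"]]
        has_integral_integral_lborel[OF i[of v]]] has_integral_integral_lborel[OF i[of w]]] eq
      by simp
    moreover have "(\<lambda>y. indicator ?Q y * dirderiv f (v + w) y - indicator ?Q y * dirderiv f v y - indicator ?Q y * dirderiv f w y)
       = (\<lambda>y. if y \<in> ?Q then k y else 0)"
      by (auto simp: k_def indicator_def)
    ultimately show ?thesis by (simp only: has_integral_restrict_UNIV)
  qed
  from AE_eq_0_if_integral_cbox_eq_0[OF this] show ?thesis
    by eventually_elim (simp add: k_def)
qed

lemma AE_dirderiv_linear:
  "AE x in lborel. has_dirderiv f (v \<bullet> (\<Sum>b\<in>Basis. dirderiv f b x *\<^sub>R b)) v x"
proof -
  have sum: "AE x in lborel. dirderiv f (\<Sum>b\<in>S. (v \<bullet> b) *\<^sub>R b) x = (\<Sum>b\<in>S. (v \<bullet> b) * dirderiv f b x)"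
    if "finite S" for S :: "'a set"
    using that
  proof (induction S)
    case empty
    have "has_dirderiv f 0 0 x" for x by (simp add: has_dirderiv_def)
    then show ?case using has_dirderiv_imp_dirderiv_eq by fastforce
  next
    case (insert c S)
    have "AE x in lborel. dirderiv f ((v \<bullet> c) *\<^sub>R c) x = (v \<bullet> c) * dirderiv f c x"
      using AE_has_dirderiv[of c]
      by eventually_elim (blast intro: has_dirderiv_imp_dirderiv_eq has_dirderiv_scaleR)
    with insert.IH dirderiv_add[of "(v \<bullet> c) *\<^sub>R c" "\<Sum>b\<in>S. (v \<bullet> b) *\<^sub>R b"] show ?case
      by eventually_elim (simp add: insert.hyps)
  qed
  have "AE x in lborel. dirderiv f v x = (\<Sum>b\<in>Basis. (v \<bullet> b) * dirderiv f b x)"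
    using sum[OF finite_Basis] by (simp add: euclidean_representation)
  with AE_has_dirderiv[of v] show ?thesis
    by eventually_elim (simp add: inner_sum_right mult.commute)
qed

text \<open>
  Given \<open>e\<close>, finitely many directions of \<open>D\<close> form an \<open>\<eta>\<close>-net of the unit sphere, and on these the
  difference quotients converge simultaneously. Replacing an arbitrary unit vector by a point of the
  net changes the difference quotient by at most \<open>\<eta> L\<close> and the linear part by at most \<open>\<eta> \<parallel>G\<parallel>\<close>.
\<close>

lemma GDERIV_if_dirderiv_dense:
  assumes dense: "closure D = UNIV"
    and dd: "\<And>v. v \<in> D \<Longrightarrow> has_dirderiv f (v \<bullet> G) v x"
  shows "GDERIV f x :> G"
  unfolding gderiv_def has_derivative_at_alt
proof (intro conjI allI impI)
  show "bounded_linear (\<lambda>h. h \<bullet> G)" by (rule bounded_linear_inner_left)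
  fix e :: real assume "e > 0"
  define M where "M = L + norm G + 1"
  define \<eta> where "\<eta> = e / (2 * M)"
  have M: "M > 0" using L_nonneg by (simp add: M_def add_nonneg_pos)
  have "\<eta> > 0" unfolding \<eta>_def using \<open>e > 0\<close> M by simp
  have "\<eta> * M = e / 2" unfolding \<eta>_def using M by simp
  then have "\<eta> * (L + norm G + 1) = e / 2" by (simp only: M_def)
  then have \<eta>: "\<eta> * L + \<eta> * norm G \<le> e / 2" using \<open>\<eta> > 0\<close> by (simp add: algebra_simps)
  have "sphere 0 1 \<subseteq> (\<Union>v\<in>D. ball v \<eta>)"
  proof
    fix u :: 'a
    have "u \<in> closure D" using dense by simp
    then obtain v where "v \<in> D" "dist v u < \<eta>"
      using \<open>\<eta> > 0\<close> unfolding closure_approachable by blast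
    then show "u \<in> (\<Union>v\<in>D. ball v \<eta>)" by auto
  qed
  then obtain F where F: "F \<subseteq> D" "finite F" "sphere 0 1 \<subseteq> (\<Union>v\<in>F. ball v \<eta>)"
    using compactE_image[OF compact_sphere, of D "\<lambda>v. ball v \<eta>" 0 1] by (metis open_ball)
  have "\<forall>\<^sub>F t in at 0. \<forall>v\<in>F. dist ((f (x + t *\<^sub>R v) - f x) / t) (v \<bullet> G) < e / 2"
    using F(1,2) dd \<open>e > 0\<close> unfolding has_dirderiv_def
    by (intro eventually_ball_finite ballI tendstoD) auto
  then obtain d where "d > 0" and
    d: "\<And>t v. t \<noteq> 0 \<Longrightarrow> \<bar>t\<bar> < d \<Longrightarrow> v \<in> F \<Longrightarrow> \<bar>(f (x + t *\<^sub>R v) - f x) / t - v \<bullet> G\<bar> < e / 2"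
    unfolding eventually_at by (auto simp: dist_real_def)
  have "norm (f y - f x - (y - x) \<bullet> G) \<le> e * norm (y - x)" if "norm (y - x) < d" for y
  proof (cases "y = x")
    case False
    define t where "t = norm (y - x)"
    define u where "u = (1 / t) *\<^sub>R (y - x)"
    have "t > 0" "t < d" using False that by (auto simp: t_def)
    have y: "y = x + t *\<^sub>R u" using \<open>t > 0\<close> by (simp add: u_def)
    have "u \<in> sphere 0 1" using \<open>t > 0\<close> by (simp add: u_def t_def)
    then obtain v where v: "v \<in> F" "norm (v - u) < \<eta>" using F(3) by (auto simp: dist_norm)
    have 1: "\<bar>f (x + t *\<^sub>R u) - f (x + t *\<^sub>R v)\<bar> \<le> t * (\<eta> * L)"
    proof -
      have "\<bar>f (x + t *\<^sub>R u) - f (x + t *\<^sub>R v)\<bar> \<le> L * norm (t *\<^sub>R (u - v))"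
        using lip_bound[of "x + t *\<^sub>R u" "x + t *\<^sub>R v"] by (simp add: scaleR_diff_right)
      also have "\<dots> = t * (norm (v - u) * L)" using \<open>t > 0\<close> by (simp add: norm_minus_commute)
      also have "\<dots> \<le> t * (\<eta> * L)"
        using \<open>t > 0\<close> v L_nonneg by (intro mult_left_mono mult_right_mono) auto
      finally show ?thesis .
    qed
    have 2: "\<bar>f (x + t *\<^sub>R v) - f x - t * (v \<bullet> G)\<bar> \<le> t * (e / 2)"
    proof -
      have "f (x + t *\<^sub>R v) - f x - t * (v \<bullet> G) = t * ((f (x + t *\<^sub>R v) - f x) / t - v \<bullet> G)"
        using \<open>t > 0\<close> by (simp add: field_simps)
      also have "\<bar>\<dots>\<bar> \<le> t * (e / 2)"
        unfolding abs_mult using d[of t v] \<open>t > 0\<close> \<open>t < d\<close> v by (intro mult_mono) auto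
      finally show ?thesis .
    qed
    have 3: "\<bar>t * (v \<bullet> G) - t * (u \<bullet> G)\<bar> \<le> t * (\<eta> * norm G)"
    proof -
      have "t * (v \<bullet> G) - t * (u \<bullet> G) = t * ((v - u) \<bullet> G)" by (simp add: inner_diff_left algebra_simps)
      also have "\<bar>\<dots>\<bar> \<le> t * (norm (v - u) * norm G)"
        using \<open>t > 0\<close> Cauchy_Schwarz_ineq2[of "v - u" G] by (simp add: abs_mult)
      also have "\<dots> \<le> t * (\<eta> * norm G)"
        using \<open>t > 0\<close> v by (intro mult_left_mono mult_right_mono) auto
      finally show ?thesis .
    qed
    have "\<bar>f y - f x - (y - x) \<bullet> G\<bar> = \<bar>f (x + t *\<^sub>R u) - f x - t * (u \<bullet> G)\<bar>"
      by (simp add: y)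
    also have "\<dots> \<le> t * (\<eta> * L) + t * (e / 2) + t * (\<eta> * norm G)"
      using 1 2 3 by linarith
    also have "\<dots> = t * ((\<eta> * L + \<eta> * norm G) + e / 2)" by (simp add: algebra_simps)
    also have "\<dots> \<le> t * e" using \<eta> \<open>t > 0\<close> by (intro mult_left_mono) auto
    finally show ?thesis by (simp add: t_def mult.commute)
  qed simp
  then show "\<exists>d>0. \<forall>y. norm (y - x) < d \<longrightarrow> norm (f y - f x - (y - x) \<bullet> G) \<le> e * norm (y - x)"
    using \<open>d > 0\<close> by blast
qed

end

theorem rademacher:
  fixes f :: "'a::euclidean_space \<Rightarrow> real"
  assumes "L-lipschitz_on UNIV f"
  obtains G :: "'a \<Rightarrow> 'a" where "G \<in> borel_measurable borel" "AE x in lborel. GDERIV f x :> G x"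
proof
  interpret lipschitz_function f L by standard (rule assms)
  define G :: "'a \<Rightarrow> 'a" where "G x = (\<Sum>b\<in>Basis. dirderiv f b x *\<^sub>R b)" for x
  show "G \<in> borel_measurable borel" unfolding G_def by measurable
  obtain D :: "'a set" where "countable D" "UNIV \<subseteq> closure D"
    by (rule separable[of UNIV])
  then have D: "countable D" "closure D = UNIV" by auto
  have "AE x in lborel. \<forall>v\<in>D. has_dirderiv f (v \<bullet> G x) v x"
    unfolding AE_ball_countable[OF D(1)] G_def using AE_dirderiv_linear by blast
  then show "AE x in lborel. GDERIV f x :> G x"
    by eventually_elim (use GDERIV_if_dirderiv_dense[OF D(2)] in blast)
qed

section \<open>The gradient along rays\<close>

lemma GDERIV_unique: "GDERIV f x :> D \<Longrightarrow> GDERIV f x :> E \<Longrightarrow> D = E"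
proof -
  assume "GDERIV f x :> D" "GDERIV f x :> E"
  then have "(\<lambda>h. h \<bullet> D) = (\<lambda>h. h \<bullet> E)"
    unfolding gderiv_def by (rule has_derivative_unique)
  then have "(D - E) \<bullet> D = (D - E) \<bullet> E" by metis
  then have "(D - E) \<bullet> (D - E) = 0" by (simp add: inner_diff_right)
  then show "D = E" by simp
qed

lemma grad_eq: "GDERIV f x :> D \<Longrightarrow> grad f x = D"
  unfolding grad_def using GDERIV_unique[of f x] by (auto intro!: the_equality)

lemma nn_integral_lborel_scaleR:
  fixes g :: "'a::euclidean_space \<Rightarrow> ennreal"
  assumes [measurable]: "g \<in> borel_measurable borel" and "c \<noteq> 0"
  shows "(\<integral>\<^sup>+x. g x \<partial>lborel) = ennreal (\<bar>c\<bar> ^ DIM('a)) * (\<integral>\<^sup>+x. g (c *\<^sub>R x) \<partial>lborel)"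
  by (subst lborel_affine[OF \<open>c \<noteq> 0\<close>, of 0])
    (simp add: nn_integral_density nn_integral_distr nn_integral_cmult)

lemma AE_lborel_scaleR:
  fixes P :: "'a::euclidean_space \<Rightarrow> bool"
  assumes "AE x in lborel. P x" and "c \<noteq> 0"
  shows "AE x in lborel. P (c *\<^sub>R x)"
proof -
  have "AE x in density (distr lborel borel (\<lambda>x. 0 + c *\<^sub>R x)) (\<lambda>_. ennreal (\<bar>c\<bar> ^ DIM('a))). P x"
    using assms(1) by (simp only: lborel_affine[OF \<open>c \<noteq> 0\<close>, of "0 :: 'a", symmetric])
  then have "AE x in distr lborel borel (\<lambda>x. 0 + c *\<^sub>R x). P x"
    using \<open>c \<noteq> 0\<close> by (subst (asm) AE_density) auto
  from AE_distrD[OF _ this] show ?thesis by simp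
qed

text \<open>
  A substitute for polar coordinates: for each \<open>s \<noteq> 0\<close> the dilation by \<open>s\<close> preserves null sets, and
  Fubini turns this into a statement about almost every ray.
\<close>

lemma AE_AE_lborel_scaleR:
  fixes P :: "'a::euclidean_space \<Rightarrow> bool"
  assumes "AE x in lborel. P x"
  shows "AE x in lborel. AE s in (lborel :: real measure). P (s *\<^sub>R x)"
proof -
  from assms obtain N where N: "N \<in> null_sets lborel" "{x. \<not> P x} \<subseteq> N"
    by (auto simp: eventually_ae_filter)
  have [measurable]: "N \<in> sets borel" using N(1) by auto
  have notin: "AE x in lborel. x \<notin> N" using N(1) by (rule AE_not_in)
  have "AE s in (lborel :: real measure). AE x in lborel. s *\<^sub>R x \<notin> N"
    using AE_lborel_singleton[of 0]
    by eventually_elim (use AE_lborel_scaleR[OF notin] in auto)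
  moreover have pair: "pair_sigma_finite (lborel :: 'a measure) (lborel :: real measure)"
    by (intro pair_sigma_finite.intro sigma_finite_lborel)
  moreover have "(\<lambda>z. snd z *\<^sub>R fst z) \<in> borel_measurable ((lborel :: 'a measure) \<Otimes>\<^sub>M (lborel :: real measure))"
    by measurable
  from measurable_compose[OF this, of "\<lambda>y. y \<notin> N" "count_space UNIV"] \<open>N \<in> sets borel\<close>
  have "{z \<in> space ((lborel :: 'a measure) \<Otimes>\<^sub>M (lborel :: real measure)). snd z *\<^sub>R fst z \<notin> N}
      \<in> sets (lborel \<Otimes>\<^sub>M lborel)"
    by (simp only: pred_def[symmetric]) measurable
  ultimately have "AE x in lborel. AE s in (lborel :: real measure). s *\<^sub>R x \<notin> N"
    by (subst pair_sigma_finite.AE_commute[OF pair])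
  then show ?thesis
    by eventually_elim (use N(2) in \<open>auto elim!: eventually_mono\<close>)
qed

lemma GDERIV_along_ray:
  assumes "GDERIV f (s *\<^sub>R x) :> D"
  shows "((\<lambda>s. f (s *\<^sub>R x)) has_real_derivative x \<bullet> D) (at s)"
proof -
  have "((\<lambda>s. s *\<^sub>R x) has_derivative (\<lambda>h. h *\<^sub>R x)) (at s)"
    by (auto intro!: derivative_eq_intros)
  from diff_chain_at[OF this, of f "\<lambda>h. h \<bullet> D"] assms
  show ?thesis
    by (simp add: gderiv_def o_def has_field_derivative_def mult_commute_abs)
qed

text \<open>
  On almost every ray the derivative of \<open>s \<mapsto> f (s x)\<close> is \<open>x \<bullet> G (s x)\<close> for almost every \<open>s\<close>, and its
  integral over \<open>[0, 1]\<close> is \<open>f x - f 0\<close>.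
\<close>

lemma AE_le_radial_integral:
  fixes f :: "'a::euclidean_space \<Rightarrow> real" and G :: "'a \<Rightarrow> 'a"
  assumes lip: "L-lipschitz_on UNIV f" and "f 0 = 0"
    and [measurable]: "G \<in> borel_measurable borel"
    and G: "AE x in lborel. GDERIV f x :> G x"
  shows "AE x in lborel. ennreal \<bar>f x\<bar> \<le>
    (\<integral>\<^sup>+s. ennreal (norm x) * ennreal (norm (G (s *\<^sub>R x))) * indicator {0..1} s \<partial>lborel)"
  using AE_AE_lborel_scaleR[OF G]
proof eventually_elim
  case (elim x)
  define h where "h s = x \<bullet> G (s *\<^sub>R x)" for s :: real
  have [measurable]: "h \<in> borel_measurable borel" unfolding h_def by measurable
  have "(L * norm x)-lipschitz_on UNIV (\<lambda>s. f (s *\<^sub>R x))"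
  proof (rule lipschitz_onI)
    fix s t :: real
    have "dist (f (s *\<^sub>R x)) (f (t *\<^sub>R x)) \<le> L * dist (s *\<^sub>R x) (t *\<^sub>R x)"
      by (rule lipschitz_onD[OF lip]) auto
    also have "dist (s *\<^sub>R x) (t *\<^sub>R x) = norm x * dist s t"
      by (simp add: dist_norm dist_real_def scaleR_left_diff_distrib[symmetric])
    finally show "dist (f (s *\<^sub>R x)) (f (t *\<^sub>R x)) \<le> L * norm x * dist s t" by (simp add: mult.assoc)
  qed (use lipschitz_on_nonneg[OF lip] in simp)
  then obtain g where g: "AE s in lborel. ((\<lambda>s. f (s *\<^sub>R x)) has_real_derivative g s) (at s)"
    and g_int: "\<And>a b. a \<le> b \<Longrightarrow> (g has_integral (f (b *\<^sub>R x) - f (a *\<^sub>R x))) {a..b}"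
    by (rule lipschitz_real_has_derivative_AE) blast
  have "AE s in lborel. s \<in> {0..1} \<longrightarrow> g s = h s"
    using elim g by eventually_elim (auto simp: h_def dest!: GDERIV_along_ray intro: DERIV_unique)
  from has_integral_AE[OF this] g_int[of 0 1] have h_int: "(h has_integral f x) {0..1}"
    by (simp add: \<open>f 0 = 0\<close>)
  let ?I = "\<integral>\<^sup>+s. ennreal (norm (indicator {0..1} s *\<^sub>R h s)) \<partial>lborel"
  have "ennreal \<bar>f x\<bar> \<le> ?I"
  proof (cases "?I = \<infinity>")
    case False
    then have int: "set_integrable lborel {0..1} h"
      unfolding set_integrable_def by (intro integrableI_bounded) (auto simp: less_top)
    have "f x = (\<integral>s. indicator {0..1} s *\<^sub>R h s \<partial>lborel)"
      using set_borel_integral_eq_integral(2)[OF int] integral_unique[OF h_int]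
      by (simp add: set_lebesgue_integral_def)
    then show ?thesis
      using integral_norm_bound_ennreal[OF int[unfolded set_integrable_def]] by simp
  qed simp
  also have "\<dots> \<le> (\<integral>\<^sup>+s. ennreal (norm x) * ennreal (norm (G (s *\<^sub>R x))) * indicator {0..1} s \<partial>lborel)"
    using Cauchy_Schwarz_ineq2[of x]
    by (intro nn_integral_mono) (auto simp: h_def indicator_def ennreal_mult[symmetric])
  finally show ?case .
qed

text \<open>
  As the completed measure is used, it suffices that the two sets differ by a null set.
\<close>

lemma emeasure_lebesgue_grad_superlevel:
  fixes f :: "'a::euclidean_space \<Rightarrow> real" and G :: "'a \<Rightarrow> 'a"
  assumes [measurable]: "G \<in> borel_measurable borel" and [measurable]: "X \<in> sets borel"
    and G: "AE x in lborel. GDERIV f x :> G x"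
  shows "emeasure lebesgue {x \<in> X. t \<le> norm (grad f x)} = emeasure lborel {x \<in> X. t \<le> norm (G x)}"
proof -
  let ?A = "{x \<in> X. t \<le> norm (grad f x)}" and ?B = "{x \<in> X. t \<le> norm (G x)}"
  have B: "?B \<in> sets borel" by measurable
  have "AE x in lborel. x \<in> ?B \<longleftrightarrow> x \<in> ?A"
    using G by eventually_elim (auto simp: grad_eq)
  then have ae: "AE x in lebesgue. x \<in> ?B \<longleftrightarrow> x \<in> ?A"
    by (simp only: AE_completion_iff)
  have "?A \<in> sets lebesgue"
    using completion.in_sets_AE[OF ae] B by simp
  then have "emeasure lebesgue ?A = emeasure lebesgue ?B"
    using ae B by (intro emeasure_eq_AE) (auto elim: eventually_mono)
  then show ?thesis using B by simp
qed

lemma measurable_ennreal_root [measurable]: "ennreal_root n \<in> borel_measurable borel"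
  unfolding ennreal_root_def by measurable

section \<open>The contribution of a single set\<close>

lemma nn_integral_power_tail:
  fixes a :: real
  assumes "a > 0"
  shows "(\<integral>\<^sup>+s. ennreal (1 / s ^ (n + 2)) * indicator {a..} s \<partial>lborel) = ennreal (1 / (real (n + 1) * a ^ (n + 1)))"
proof -
  define F :: "real \<Rightarrow> real" where "F s = - (1 / (real (n + 1) * s ^ (n + 1)))" for s
  have lim: "(F \<longlongrightarrow> - (1 / real (n + 1) * 0)) at_top"
  proof -
    have "((\<lambda>s::real. inverse (s ^ (n + 1))) \<longlongrightarrow> 0) at_top"
      by (intro tendsto_inverse_0_at_top filterlim_pow_at_top filterlim_ident) auto
    then have "((\<lambda>s::real. - (1 / real (n + 1) * inverse (s ^ (n + 1)))) \<longlongrightarrow> - (1 / real (n + 1) * 0)) at_top"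
      by (intro tendsto_minus tendsto_mult_left)
    then show ?thesis by (simp add: F_def[abs_def] field_simps)
  qed
  have deriv: "(F has_real_derivative 1 / s ^ (n + 2)) (at s)" if "a \<le> s" for s
  proof -
    have "s > 0" using that assms by simp
    have "((\<lambda>s. s ^ (n + 1)) has_real_derivative real (n + 1) * s ^ n) (at s)"
      using DERIV_pow[of "n + 1" s] by simp
    then have "((\<lambda>s. - (1 / real (n + 1)) * inverse (s ^ (n + 1))) has_real_derivative
      - (1 / real (n + 1)) * (- (inverse (s ^ (n + 1)) * (real (n + 1) * s ^ n) * inverse (s ^ (n + 1))))) (at s)"
      using \<open>s > 0\<close> by (intro DERIV_cmult DERIV_inverse') auto
    moreover have "- (1 / real (n + 1)) * (- (inverse (s ^ (n + 1)) * (real (n + 1) * s ^ n) * inverse (s ^ (n + 1)))) = 1 / s ^ (n + 2)"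
      using \<open>s > 0\<close> by (simp add: divide_simps)
    moreover have "F = (\<lambda>s. - (1 / real (n + 1)) * inverse (s ^ (n + 1)))"
      by (rule ext) (simp add: F_def divide_simps)
    ultimately show ?thesis by simp
  qed
  have "(\<integral>\<^sup>+s. ennreal (1 / s ^ (n + 2)) * indicator {a..} s \<partial>lborel) = - (1 / real (n + 1) * 0) - F a"
    using assms by (intro nn_integral_FTC_atLeast deriv lim) auto
  then show ?thesis by (simp add: F_def)
qed

lemma emeasure_scaleR_preimage:
  fixes E :: "'a::euclidean_space set"
  assumes [measurable]: "E \<in> sets borel" and "s > 0"
  shows "emeasure lborel {x. s *\<^sub>R x \<in> E} = ennreal (1 / s ^ DIM('a)) * emeasure lborel E"
proof -
  have S: "{x. s *\<^sub>R x \<in> E} \<in> sets borel" by measurable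
  have "emeasure lborel {x. s *\<^sub>R x \<in> E} = (\<integral>\<^sup>+x. indicator {x. s *\<^sub>R x \<in> E} x \<partial>lborel)"
    using S by simp
  also have "\<dots> = ennreal (\<bar>1 / s\<bar> ^ DIM('a)) * (\<integral>\<^sup>+x. indicator {x. s *\<^sub>R x \<in> E} ((1 / s) *\<^sub>R x) \<partial>lborel)"
    using S \<open>s > 0\<close> by (intro nn_integral_lborel_scaleR) auto
  also have "(\<integral>\<^sup>+x. indicator {x. s *\<^sub>R x \<in> E} ((1 / s) *\<^sub>R x) \<partial>lborel) = (\<integral>\<^sup>+x. indicator E x \<partial>(lborel :: 'a measure))"
    using \<open>s > 0\<close> by (intro nn_integral_cong) (auto simp: indicator_def)
  finally show ?thesis using \<open>s > 0\<close> by (simp add: power_one_over)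
qed

text \<open>
  The two bounds in the minimum cross at \<open>r = root d A / root d m\<close> with \<open>d = k + 2\<close>. The part below
  \<open>r\<close> contributes at most \<open>m r\<close>, the tail above \<open>r\<close> at most \<open>m r / (d - 1)\<close>, and \<open>1 + 1 / (d - 1) \<le> 2\<close>.
\<close>

lemma nn_integral_min_power_le:
  fixes m A :: real and k :: nat
  assumes "m > 0" "A > 0"
  shows "(\<integral>\<^sup>+s. ennreal (min m (A / s ^ (k + 2))) * indicator {0<..1} s \<partial>lborel)
    \<le> ennreal (2 * root (k + 2) m ^ (k + 1) * root (k + 2) A)"
proof -
  define a b where "a = root (k + 2) A" and "b = root (k + 2) m"
  have ab: "a > 0" "b > 0" using assms by (auto simp: a_def b_def)
  have A: "A = a ^ (k + 2)" and m: "m = b ^ (k + 2)"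
    using assms by (auto simp: a_def b_def real_root_pow_pos2 simp del: power_Suc)
  define r where "r = a / b"
  have "r > 0" using ab by (simp add: r_def)
  have "(\<integral>\<^sup>+s. ennreal (min m (A / s ^ (k + 2))) * indicator {0<..1} s \<partial>lborel)
    \<le> (\<integral>\<^sup>+s. ennreal m * indicator {0..r} s + ennreal A * (ennreal (1 / s ^ (k + 2)) * indicator {r..} s) \<partial>lborel)"
  proof (rule nn_integral_mono)
    fix s :: real
    show "ennreal (min m (A / s ^ (k + 2))) * indicator {0<..1} s
      \<le> ennreal m * indicator {0..r} s + ennreal A * (ennreal (1 / s ^ (k + 2)) * indicator {r..} s)"
    proof (cases "0 < s \<and> s \<le> 1")
      case True
      show ?thesis
      proof (cases "s \<le> r")
        case True
        then have "ennreal (min m (A / s ^ (k + 2))) \<le> ennreal m * indicator {0..r} s"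
          using \<open>0 < s \<and> s \<le> 1\<close> by (simp add: ennreal_leI)
        then show ?thesis using \<open>0 < s \<and> s \<le> 1\<close> by (simp add: add_increasing2)
      next
        case False
        then have "ennreal (min m (A / s ^ (k + 2))) \<le> ennreal A * (ennreal (1 / s ^ (k + 2)) * indicator {r..} s)"
          using \<open>0 < s \<and> s \<le> 1\<close> \<open>A > 0\<close> by (simp add: ennreal_leI ennreal_mult[symmetric] del: power_Suc)
        then show ?thesis using \<open>0 < s \<and> s \<le> 1\<close> by (simp add: add_increasing)
      qed
    next
      case False
      then have "s \<notin> {0<..1}" by auto
      then show ?thesis by simp
    qed
  qed
  also have "\<dots> = ennreal m * ennreal r + ennreal A * ennreal (1 / (real (k + 1) * r ^ (k + 1)))"
    using \<open>r > 0\<close> nn_integral_power_tail[OF \<open>r > 0\<close>, of k]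
    by (simp add: nn_integral_add nn_integral_cmult nn_integral_cmult_indicator del: power_Suc)
  also have "\<dots> = ennreal (m * r + A * (1 / (real (k + 1) * r ^ (k + 1))))"
  proof -
    have P: "1 / (real (k + 1) * r ^ (k + 1)) \<ge> 0" using \<open>r > 0\<close> by simp
    show ?thesis
      unfolding ennreal_mult[OF less_imp_le[OF \<open>A > 0\<close>] P, symmetric]
        ennreal_mult[OF less_imp_le[OF \<open>m > 0\<close>] less_imp_le[OF \<open>r > 0\<close>], symmetric]
      by (rule ennreal_plus[symmetric]) (use assms \<open>r > 0\<close> P in \<open>auto intro: mult_nonneg_nonneg\<close>)
  qed
  also have "m * r + A * (1 / (real (k + 1) * r ^ (k + 1))) = b ^ (k + 1) * a * (1 + 1 / real (k + 1))"
  proof -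
    have "m * r = b ^ (k + 1) * a" using ab by (simp add: m r_def)
    moreover have "A * (1 / (real (k + 1) * r ^ (k + 1))) = b ^ (k + 1) * a * (1 / real (k + 1))"
    proof -
      have "A = a ^ (k + 1) * a" by (simp add: A)
      moreover have "r ^ (k + 1) = a ^ (k + 1) / b ^ (k + 1)" by (simp only: r_def power_divide)
      moreover have "x * a * (1 / (c * (x / y))) = y * a * (1 / c)" if "x > 0" "y > 0" "c > 0" for x y c :: real
        using that by (simp add: field_simps)
      from this[of "a ^ (k + 1)" "b ^ (k + 1)" "real (k + 1)"]
      have "a ^ (k + 1) * a * (1 / (real (k + 1) * (a ^ (k + 1) / b ^ (k + 1)))) = b ^ (k + 1) * a * (1 / real (k + 1))"
        using ab by simp
      ultimately show ?thesis by (simp only:)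
    qed
    ultimately show ?thesis by (simp only: distrib_left mult_1_right)
  qed
  also have "b ^ (k + 1) * a * (1 + 1 / real (k + 1)) \<le> b ^ (k + 1) * a * 2"
    using ab by (intro mult_left_mono) auto
  finally show ?thesis by (simp add: a_def b_def ennreal_leI mult_ac)
qed

locale ball_supported_measure =
  fixes \<mu> :: "'a::euclidean_space measure" and R :: real
  assumes R: "R > 0"
    and sets_\<mu> [measurable_cong]: "sets \<mu> = sets borel"
    and le_lborel: "\<And>A. A \<in> sets borel \<Longrightarrow> emeasure \<mu> A \<le> emeasure lborel A"
    and outside: "emeasure \<mu> (- cball 0 R) = 0"
begin

lemma space_\<mu>: "space \<mu> = UNIV"
  using sets_eq_imp_space_eq[OF sets_\<mu>] by simp

lemma AE_in_cball: "AE x in \<mu>. x \<in> cball 0 R"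
  by (rule AE_I[OF _ outside]) (auto simp: space_\<mu> sets_\<mu>)

lemma finite_\<mu>: "finite_measure \<mu>"
proof
  have "emeasure \<mu> (space \<mu>) \<le> emeasure \<mu> (cball 0 R) + emeasure \<mu> (- cball 0 R)"
    by (rule order_trans[OF _ emeasure_subadditive]) (auto simp: space_\<mu> sets_\<mu>)
  also have "\<dots> \<le> emeasure lborel (cball (0 :: 'a) R)"
    using le_lborel[of "cball 0 R"] outside by simp
  also have "\<dots> < \<infinity>" by (intro emeasure_bounded_finite) auto
  finally show "emeasure \<mu> (space \<mu>) \<noteq> \<infinity>" by auto
qed

lemma nn_integral_\<mu>_le_lborel: "(\<integral>\<^sup>+x. g x \<partial>\<mu>) \<le> (\<integral>\<^sup>+x. g x \<partial>lborel)"
  by (intro nn_integral_mono_measure) (auto simp: sets_\<mu> le_measure le_lborel)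

lemma emeasure_scaled_preimage_le:
  assumes E [measurable]: "E \<in> sets borel" and fin: "emeasure lborel E < \<infinity>" and "s > 0"
  shows "emeasure \<mu> {x. s *\<^sub>R x \<in> E} \<le> ennreal (min (measure \<mu> UNIV) (measure lborel E / s ^ DIM('a)))"
proof -
  interpret finite_measure \<mu> by (rule finite_\<mu>)
  have S: "{x. s *\<^sub>R x \<in> E} \<in> sets borel" by measurable
  have "emeasure \<mu> {x. s *\<^sub>R x \<in> E} \<le> ennreal (measure \<mu> UNIV)"
    unfolding emeasure_eq_measure using S finite_measure_mono[of "{x. s *\<^sub>R x \<in> E}" UNIV]
    by (intro ennreal_leI) (auto simp: sets_\<mu>)
  moreover have "emeasure \<mu> {x. s *\<^sub>R x \<in> E} \<le> ennreal (measure lborel E / s ^ DIM('a))"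
  proof -
    have "emeasure \<mu> {x. s *\<^sub>R x \<in> E} \<le> ennreal (1 / s ^ DIM('a)) * emeasure lborel E"
      using le_lborel[OF S] emeasure_scaleR_preimage[OF E \<open>s > 0\<close>] by simp
    also have "emeasure lborel E = ennreal (measure lborel E)"
      using fin by (intro emeasure_eq_ennreal_measure) auto
    finally show ?thesis using \<open>s > 0\<close> by (simp add: ennreal_mult[symmetric])
  qed
  ultimately show ?thesis by (simp add: min_def)
qed

text \<open>
  With \<open>\<parallel>x\<parallel> \<le> R\<close> on the support of \<open>\<mu>\<close>, only \<open>\<mu> {x. s x \<in> E}\<close> remains to be integrated over \<open>s\<close>.
\<close>

lemma radial_kernel_bound_higher_dim:
  assumes E [measurable]: "E \<in> sets borel" and fin: "emeasure lborel E < \<infinity>" and d: "DIM('a) \<ge> 2"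
    and m: "measure \<mu> UNIV > 0"
  shows "(\<integral>\<^sup>+s. (\<integral>\<^sup>+x. ennreal (norm x) * indicator E (s *\<^sub>R x) \<partial>\<mu>) * indicator {0..1} s \<partial>lborel)
    \<le> ennreal (2 * R * root DIM('a) (measure \<mu> UNIV) ^ (DIM('a) - 1) * root DIM('a) (measure lborel E))"
proof -
  define k where "k = DIM('a) - 2"
  have k: "DIM('a) = k + 2" using d by (simp add: k_def)
  let ?m = "measure \<mu> UNIV" and ?A = "measure lborel E"
  have inner: "(\<integral>\<^sup>+x. ennreal (norm x) * indicator E (s *\<^sub>R x) \<partial>\<mu>)
      \<le> ennreal R * ennreal (min ?m (?A / s ^ DIM('a)))" if "s > 0" for s
  proof -
    have S: "{x. s *\<^sub>R x \<in> E} \<in> sets \<mu>" unfolding sets_\<mu> by measurable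
    have "(\<integral>\<^sup>+x. ennreal (norm x) * indicator E (s *\<^sub>R x) \<partial>\<mu>)
      \<le> (\<integral>\<^sup>+x. ennreal R * indicator {x. s *\<^sub>R x \<in> E} x \<partial>\<mu>)"
      using AE_in_cball by (intro nn_integral_mono_AE, eventually_elim) (auto simp: indicator_def ennreal_leI)
    also have "\<dots> = ennreal R * emeasure \<mu> {x. s *\<^sub>R x \<in> E}"
      using S by (rule nn_integral_cmult_indicator)
    also have "\<dots> \<le> ennreal R * ennreal (min ?m (?A / s ^ DIM('a)))"
      by (intro mult_left_mono emeasure_scaled_preimage_le E fin that) auto
    finally show ?thesis .
  qed
  have "(\<integral>\<^sup>+s. (\<integral>\<^sup>+x. ennreal (norm x) * indicator E (s *\<^sub>R x) \<partial>\<mu>) * indicator {0..1} s \<partial>lborel)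
    \<le> (\<integral>\<^sup>+s. ennreal R * (ennreal (min ?m (?A / s ^ DIM('a))) * indicator {0<..1} s) \<partial>lborel)"
  proof (rule nn_integral_mono_AE)
    show "AE s in lborel. (\<integral>\<^sup>+x. ennreal (norm x) * indicator E (s *\<^sub>R x) \<partial>\<mu>) * indicator {0..1} s
      \<le> ennreal R * (ennreal (min ?m (?A / s ^ DIM('a))) * indicator {0<..1} s)"
      using AE_lborel_singleton[of 0]
    proof eventually_elim
      case (elim s)
      then show ?case using inner[of s] by (cases "s \<in> {0..1}") auto
    qed
  qed
  also have "\<dots> = ennreal R * (\<integral>\<^sup>+s. ennreal (min ?m (?A / s ^ DIM('a))) * indicator {0<..1} s \<partial>lborel)"
    by (intro nn_integral_cmult) auto
  also have "\<dots> \<le> ennreal R * ennreal (2 * root DIM('a) ?m ^ (DIM('a) - 1) * root DIM('a) ?A)"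
  proof (intro mult_left_mono)
    show "(\<integral>\<^sup>+s. ennreal (min ?m (?A / s ^ DIM('a))) * indicator {0<..1} s \<partial>lborel)
      \<le> ennreal (2 * root DIM('a) ?m ^ (DIM('a) - 1) * root DIM('a) ?A)"
    proof (cases "?A = 0")
      case True
      then show ?thesis using m by (simp add: min_def)
    next
      case False
      then have "?A > 0" by (simp add: zero_less_measure_iff)
      from nn_integral_min_power_le[OF m this, of k] show ?thesis by (simp add: k)
    qed
  qed auto
  also have "\<dots> = ennreal (2 * R * root DIM('a) ?m ^ (DIM('a) - 1) * root DIM('a) ?A)"
    using R m by (simp add: ennreal_mult[symmetric] mult_ac)
  finally show ?thesis .
qed

text \<open>
  Since \<open>\<mu> \<le> dx\<close>, the substitution \<open>y = s x\<close> turns the left-hand side into an integral over \<open>E\<close> of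
  \<open>\<parallel>y\<parallel> \<integral> s\<^sup>-\<^sup>2 ds\<close>, where \<open>\<parallel>x\<parallel> \<le> R\<close> has become \<open>s \<ge> \<parallel>y\<parallel> / R\<close>; the inner integral is at most
  \<open>R / \<parallel>y\<parallel>\<close>.
\<close>

lemma radial_kernel_bound_dim1:
  assumes E [measurable]: "E \<in> sets borel" and d: "DIM('a) = 1"
  shows "(\<integral>\<^sup>+s. (\<integral>\<^sup>+x. ennreal (norm x) * indicator E (s *\<^sub>R x) \<partial>\<mu>) * indicator {0..1} s \<partial>lborel)
    \<le> ennreal R * emeasure lborel E"
proof -
  \<comment> \<open>One factor \<open>1 / s\<close> is the Jacobian, the other comes from \<open>\<parallel>x\<parallel> = \<parallel>y\<parallel> / s\<close>.\<close>
  define F where "F s y = ennreal (1 / s) * ennreal (norm y / s) * indicator E y *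
      (if norm y / R \<le> s then 1 else 0) * indicator {0<..1} s"
    for s :: real and y :: 'a
  have inner: "(\<integral>\<^sup>+x. ennreal (norm x) * indicator E (s *\<^sub>R x) \<partial>\<mu>) \<le> (\<integral>\<^sup>+y. F s y \<partial>lborel)"
    if s: "0 < s" "s \<le> 1" for s
  proof -
    let ?g = "\<lambda>x :: 'a. ennreal (norm x) * indicator E (s *\<^sub>R x) * indicator (cball 0 R) x"
    have [measurable]: "cball (0 :: 'a) R \<in> sets borel" by simp
    have [measurable]: "?g \<in> borel_measurable borel" by measurable
    have m': "(\<lambda>y. ?g ((1 / s) *\<^sub>R y)) \<in> borel_measurable lborel" by measurable
    have "(\<integral>\<^sup>+x. ennreal (norm x) * indicator E (s *\<^sub>R x) \<partial>\<mu>) = (\<integral>\<^sup>+x. ?g x \<partial>\<mu>)"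
      using AE_in_cball by (intro nn_integral_cong_AE, eventually_elim) auto
    also have "\<dots> \<le> (\<integral>\<^sup>+x. ?g x \<partial>lborel)" by (rule nn_integral_\<mu>_le_lborel)
    also have "\<dots> = ennreal (\<bar>1 / s\<bar> ^ DIM('a)) * (\<integral>\<^sup>+y. ?g ((1 / s) *\<^sub>R y) \<partial>lborel)"
      using s by (intro nn_integral_lborel_scaleR) auto
    also have "\<dots> = (\<integral>\<^sup>+y. ennreal (1 / s) * ?g ((1 / s) *\<^sub>R y) \<partial>lborel)"
      using s by (subst nn_integral_cmult[OF m']) (simp add: d)
    also have "\<dots> \<le> (\<integral>\<^sup>+y. F s y \<partial>lborel)"
      using s R by (intro nn_integral_mono) (auto simp: F_def indicator_def field_simps)
    finally show ?thesis .
  qed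
  have [measurable]: "case_prod F \<in> borel_measurable (lborel \<Otimes>\<^sub>M lborel)"
    unfolding F_def by measurable
  have pair: "pair_sigma_finite (lborel :: real measure) (lborel :: 'a measure)"
    by (intro pair_sigma_finite.intro sigma_finite_lborel)
  have outer: "(\<integral>\<^sup>+s. F s y \<partial>lborel) \<le> ennreal R * indicator E y" for y
  proof (cases "y = 0 \<or> y \<notin> E")
    case False
    then have y: "norm y / R > 0" using R by auto
    have "(\<integral>\<^sup>+s. F s y \<partial>lborel) \<le> (\<integral>\<^sup>+s. ennreal (norm y) * (ennreal (1 / s ^ (0 + 2)) * indicator {norm y / R..} s) \<partial>lborel)"
      by (intro nn_integral_mono)
        (auto simp: F_def indicator_def ennreal_mult[symmetric] power2_eq_square)
    also have "\<dots> = ennreal (norm y) * (\<integral>\<^sup>+s. ennreal (1 / s ^ (0 + 2)) * indicator {norm y / R..} s \<partial>lborel)"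
      by (intro nn_integral_cmult) auto
    also have "\<dots> = ennreal (norm y) * ennreal (1 / (norm y / R))"
      by (subst nn_integral_power_tail[OF y]) simp
    also have "\<dots> = ennreal R"
      using y R False by (simp add: ennreal_mult[symmetric])
    finally show ?thesis using False by simp
  qed (auto simp: F_def)
  have "(\<integral>\<^sup>+s. (\<integral>\<^sup>+x. ennreal (norm x) * indicator E (s *\<^sub>R x) \<partial>\<mu>) * indicator {0..1} s \<partial>lborel)
    \<le> (\<integral>\<^sup>+s. (\<integral>\<^sup>+y. F s y \<partial>lborel) \<partial>lborel)"
  proof (rule nn_integral_mono_AE)
    show "AE s in lborel. (\<integral>\<^sup>+x. ennreal (norm x) * indicator E (s *\<^sub>R x) \<partial>\<mu>) * indicator {0..1} s
      \<le> (\<integral>\<^sup>+y. F s y \<partial>lborel)"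
      using AE_lborel_singleton[of 0]
    proof eventually_elim
      case (elim s)
      then show ?case using inner[of s] by (cases "s \<in> {0..1}") auto
    qed
  qed
  also have "\<dots> = (\<integral>\<^sup>+y. (\<integral>\<^sup>+s. F s y \<partial>lborel) \<partial>lborel)"
    by (rule pair_sigma_finite.Fubini'[OF pair, symmetric]) measurable
  also have "\<dots> \<le> (\<integral>\<^sup>+y. ennreal R * indicator E y \<partial>lborel)"
    by (intro nn_integral_mono outer)
  also have "\<dots> = ennreal R * emeasure lborel E"
    by (rule nn_integral_cmult_indicator) simp
  finally show ?thesis .
qed

text \<open>
  For \<open>d = 1\<close> the exponent of the total mass is \<open>0\<close>, and \<open>0 powr 0 = 0\<close>; this is why the zero measure
  is treated first.
\<close>

lemma radial_kernel_bound:
  assumes E [measurable]: "E \<in> sets borel" and fin: "emeasure lborel E < \<infinity>"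
  shows "(\<integral>\<^sup>+s. (\<integral>\<^sup>+x. ennreal (norm x) * indicator E (s *\<^sub>R x) \<partial>\<mu>) * indicator {0..1} s \<partial>lborel)
    \<le> ennreal (2 * R * measure \<mu> UNIV powr ((real DIM('a) - 1) / real DIM('a))) * ennreal_root DIM('a) (emeasure lborel E)"
proof (cases "measure \<mu> UNIV = 0")
  case True
  then have "emeasure \<mu> (space \<mu>) = 0"
    using finite_measure.emeasure_eq_measure[OF finite_\<mu>] by (simp add: space_\<mu>)
  then have "(\<integral>\<^sup>+x. g x \<partial>\<mu>) = 0" for g
    using nn_integral_null_set[of "space \<mu>" \<mu> g] by (simp add: null_sets_def space_\<mu>)
  then show ?thesis by simp
next
  case False
  then have m: "measure \<mu> UNIV > 0" by (simp add: zero_less_measure_iff)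
  have root: "ennreal_root DIM('a) (emeasure lborel E) = ennreal (root DIM('a) (measure lborel E))"
    using fin by (auto simp: ennreal_root_def measure_def)
  consider "DIM('a) = 1" | "DIM('a) \<ge> 2" using DIM_positive[where 'a='a] by linarith
  then show ?thesis
  proof cases
    case 1
    have E: "emeasure lborel E = ennreal (measure lborel E)"
      using fin by (intro emeasure_eq_ennreal_measure) auto
    have "ennreal R * emeasure lborel E = ennreal (R * measure lborel E)"
      using R by (simp add: E ennreal_mult)
    also have "\<dots> \<le> ennreal (2 * R * measure lborel E)"
      using R by (intro ennreal_leI mult_right_mono) auto
    finally show ?thesis
      using radial_kernel_bound_dim1[OF assms(1) 1] m R unfolding root
      by (simp add: 1 ennreal_mult[symmetric])
  next
    case 2
    have "root DIM('a) (measure \<mu> UNIV) ^ (DIM('a) - 1) = measure \<mu> UNIV powr ((real DIM('a) - 1) / real DIM('a))"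
      using m 2 by (simp add: root_powr_inverse powr_realpow[symmetric] powr_powr of_nat_diff)
    then show ?thesis
      using radial_kernel_bound_higher_dim[OF assms 2 m] R
      by (simp add: root ennreal_mult[symmetric])
  qed
qed

section \<open>Integration over all superlevel sets\<close>

text \<open>
  The layer-cake formula and Tonelli reduce the estimate to the sets \<open>E t\<close>. For \<open>x\<close> in the ball and
  \<open>s \<le> 1\<close> the point \<open>s x\<close> is in the ball as well, so that cutting the superlevel sets off outside the
  ball loses nothing.
\<close>

lemma nn_integral_radial_le_lorentz:
  fixes G :: "'a \<Rightarrow> 'a"
  assumes [measurable]: "G \<in> borel_measurable borel"
  shows "(\<integral>\<^sup>+x. (\<integral>\<^sup>+s. ennreal (norm x) * ennreal (norm (G (s *\<^sub>R x))) * indicator {0..1} s \<partial>lborel) \<partial>\<mu>)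
    \<le> ennreal (2 * R * measure \<mu> UNIV powr ((real DIM('a) - 1) / real DIM('a))) *
      (\<integral>\<^sup>+t\<in>{0..}. ennreal_root DIM('a) (emeasure lborel {y \<in> cball 0 R. t \<le> norm (G y)}) \<partial>lborel)"
proof -
  interpret mu: finite_measure \<mu> by (rule finite_\<mu>)
  let ?K = "ennreal (2 * R * measure \<mu> UNIV powr ((real DIM('a) - 1) / real DIM('a)))"
  define E where "E t = {y \<in> cball 0 R. t \<le> norm (G y)}" for t
  define F :: "real \<Rightarrow> 'a \<Rightarrow> real \<Rightarrow> ennreal" where "F s x t = ennreal (norm x) * (if norm (s *\<^sub>R x) \<le> R \<and> t \<le> norm (G (s *\<^sub>R x)) then 1 else 0) *
      indicator {0..1} s * indicator {0..} t" for s x t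
  have [measurable]: "(\<lambda>z. F (f z) (g z) (h z)) \<in> borel_measurable M"
    if [measurable]: "f \<in> borel_measurable M" "g \<in> borel_measurable M" "h \<in> borel_measurable M" for f g h and M :: "'c measure"
    unfolding F_def by measurable
  have pair_rr: "pair_sigma_finite (lborel :: real measure) (lborel :: real measure)"
    and pair_\<mu>r: "pair_sigma_finite \<mu> (lborel :: real measure)"
    by (intro pair_sigma_finite.intro sigma_finite_lborel mu.sigma_finite_measure_axioms)+
  have layer: "ennreal (norm x) * ennreal (norm (G (s *\<^sub>R x))) * indicator {0..1} s = (\<integral>\<^sup>+t. F s x t \<partial>lborel)"
    if x: "x \<in> cball 0 R" for s x
  proof (cases "s \<in> {0..1}")
    case True
    have "norm (s *\<^sub>R x) \<le> 1 * R"
      unfolding norm_scaleR using True x by (intro mult_mono) auto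
    then have "(\<integral>\<^sup>+t. F s x t \<partial>lborel) = (\<integral>\<^sup>+t. ennreal (norm x) * indicator {0..norm (G (s *\<^sub>R x))} t \<partial>lborel)"
      using True by (intro nn_integral_cong) (auto simp: F_def indicator_def)
    also have "\<dots> = ennreal (norm x) * ennreal (norm (G (s *\<^sub>R x)))"
      by (subst nn_integral_cmult_indicator) auto
    finally show ?thesis using True by simp
  qed (simp add: F_def)
  have "(\<integral>\<^sup>+x. (\<integral>\<^sup>+s. ennreal (norm x) * ennreal (norm (G (s *\<^sub>R x))) * indicator {0..1} s \<partial>lborel) \<partial>\<mu>)
     = (\<integral>\<^sup>+x. (\<integral>\<^sup>+s. (\<integral>\<^sup>+t. F s x t \<partial>lborel) \<partial>lborel) \<partial>\<mu>)"
    using AE_in_cball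
    by (intro nn_integral_cong_AE, eventually_elim) (simp add: layer)
  also have "\<dots> = (\<integral>\<^sup>+x. (\<integral>\<^sup>+t. (\<integral>\<^sup>+s. F s x t \<partial>lborel) \<partial>lborel) \<partial>\<mu>)"
    by (intro nn_integral_cong pair_sigma_finite.Fubini'[OF pair_rr, symmetric]) measurable
  also have "\<dots> = (\<integral>\<^sup>+t. (\<integral>\<^sup>+x. (\<integral>\<^sup>+s. F s x t \<partial>lborel) \<partial>\<mu>) \<partial>lborel)"
    by (rule pair_sigma_finite.Fubini'[OF pair_\<mu>r, symmetric]) measurable
  also have "\<dots> = (\<integral>\<^sup>+t. (\<integral>\<^sup>+s. (\<integral>\<^sup>+x. F s x t \<partial>\<mu>) \<partial>lborel) \<partial>lborel)"
    by (intro nn_integral_cong pair_sigma_finite.Fubini'[OF pair_\<mu>r, symmetric]) measurable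
  also have "\<dots> \<le> (\<integral>\<^sup>+t. ?K * (ennreal_root DIM('a) (emeasure lborel (E t)) * indicator {0..} t) \<partial>lborel)"
  proof (rule nn_integral_mono)
    fix t :: real
    have cb [measurable]: "cball (0 :: 'a) R \<in> sets borel" by simp
    have E [measurable]: "E t \<in> sets borel" unfolding E_def by measurable
    have "emeasure lborel (E t) < \<infinity>"
      by (intro emeasure_bounded_finite bounded_subset[OF bounded_cball[of 0 R]]) (auto simp: E_def)
    note K = radial_kernel_bound[OF E this]
    show "(\<integral>\<^sup>+s. (\<integral>\<^sup>+x. F s x t \<partial>\<mu>) \<partial>lborel)
       \<le> ?K * (ennreal_root DIM('a) (emeasure lborel (E t)) * indicator {0..} t)"
    proof (cases "t \<ge> 0")
      case True
      have "(\<integral>\<^sup>+x. F s x t \<partial>\<mu>) = (\<integral>\<^sup>+x. ennreal (norm x) * indicator (E t) (s *\<^sub>R x) \<partial>\<mu>) * indicator {0..1} s" for s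
        using True by (subst nn_integral_multc[symmetric])
          (auto simp: F_def E_def indicator_def intro!: nn_integral_cong)
      then show ?thesis using K True by simp
    qed (simp add: F_def)
  qed
  also have "\<dots> = ?K * (\<integral>\<^sup>+t. ennreal_root DIM('a) (emeasure lborel (E t)) * indicator {0..} t \<partial>lborel)"
  proof (rule nn_integral_cmult)
    have "emeasure lborel (E t) = (\<integral>\<^sup>+y. (if norm y \<le> R \<and> t \<le> norm (G y) then 1 else 0) \<partial>lborel)" for t
    proof -
      have cb [measurable]: "cball (0 :: 'a) R \<in> sets borel" by simp
      have E [measurable]: "E t \<in> sets borel" unfolding E_def by measurable
      then have "emeasure lborel (E t) = (\<integral>\<^sup>+y. indicator (E t) y \<partial>lborel)" by simp
      also have "\<dots> = (\<integral>\<^sup>+y. (if norm y \<le> R \<and> t \<le> norm (G y) then 1 else 0) \<partial>lborel)"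
        by (intro nn_integral_cong) (auto simp: E_def indicator_def)
      finally show ?thesis .
    qed
    then have [measurable]: "(\<lambda>t. emeasure lborel (E t)) \<in> borel_measurable borel" by simp
    show "(\<lambda>t. ennreal_root DIM('a) (emeasure lborel (E t)) * indicator {0..} t) \<in> borel_measurable lborel"
      by measurable
  qed
  finally show ?thesis unfolding E_def .
qed

lemma abs_integral_le_lorentz:
  fixes f :: "'a \<Rightarrow> real"
  assumes ac: "absolutely_continuous lborel \<mu>"
    and lip: "L-lipschitz_on UNIV f" and f0: "f 0 = 0"
  shows "ennreal \<bar>\<integral>x. f x \<partial>\<mu>\<bar> \<le>
    ennreal (2 * R * measure \<mu> UNIV powr ((real DIM('a) - 1) / real DIM('a))) * lorentz_d1_norm (cball 0 R) (grad f)"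
proof -
  let ?K = "ennreal (2 * R * measure \<mu> UNIV powr ((real DIM('a) - 1) / real DIM('a)))"
  obtain G :: "'a \<Rightarrow> 'a" where [measurable]: "G \<in> borel_measurable borel" and G: "AE x in lborel. GDERIV f x :> G x"
    using rademacher[OF lip] .
  let ?I = "\<integral>\<^sup>+t\<in>{0..}. ennreal_root DIM('a) (emeasure lebesgue {y \<in> cball 0 R. norm (grad f y) \<ge> t}) \<partial>lborel"
  have "ennreal \<bar>\<integral>x. f x \<partial>\<mu>\<bar> \<le> (\<integral>\<^sup>+x. ennreal \<bar>f x\<bar> \<partial>\<mu>)"
  proof (cases "integrable \<mu> f")
    case True
    from integral_norm_bound_ennreal[OF this] show ?thesis by simp
  qed (simp add: not_integrable_integral_eq)
  also have "\<dots> \<le> (\<integral>\<^sup>+x. (\<integral>\<^sup>+s. ennreal (norm x) * ennreal (norm (G (s *\<^sub>R x))) * indicator {0..1} s \<partial>lborel) \<partial>\<mu>)"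
    by (intro nn_integral_mono_AE absolutely_continuous_AE[OF _ ac] AE_le_radial_integral[OF lip f0 _ G])
      (simp_all add: sets_\<mu>)
  also have "\<dots> \<le> ?K * ?I"
  proof -
    have "emeasure lebesgue {y \<in> cball 0 R. t \<le> norm (grad f y)} = emeasure lborel {y \<in> cball 0 R. t \<le> norm (G y)}" for t
      by (rule emeasure_lebesgue_grad_superlevel[OF _ _ G]) auto
    then show ?thesis using nn_integral_radial_le_lorentz[of G] by (simp only:) simp
  qed
  also have "\<dots> \<le> ?K * lorentz_d1_norm (cball 0 R) (grad f)"
  proof (rule mult_left_mono)
    have "of_nat 1 \<le> (of_nat DIM('a) :: ennreal)"
      by (intro of_nat_mono) (simp add: Suc_le_eq)
    then have "1 * ?I \<le> of_nat DIM('a) * ?I"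
      by (intro mult_right_mono) auto
    then show "?I \<le> lorentz_d1_norm (cball 0 R) (grad f)" by (simp add: lorentz_d1_norm_def)
  qed simp
  finally show ?thesis .
qed

end

text \<open>
  The complement is a union of open null sets, and by Lindelof's theorem countably many of them cover it.
\<close>

lemma emeasure_compl_measure_support:
  fixes M :: "'a::second_countable_topology measure"
  assumes sets: "sets M = sets borel"
  shows "emeasure M (- measure_support M) = 0"
proof -
  define \<F> where "\<F> = {U. open U \<and> emeasure M U = 0}"
  obtain \<F>' where F': "\<F>' \<subseteq> \<F>" "countable \<F>'" "\<Union>\<F>' = \<Union>\<F>"
    using Lindelof[of \<F>] by (auto simp: \<F>_def)
  have "(\<Union>U\<in>\<F>'. U) \<in> null_sets M"
    using F'(1,2) by (intro null_sets_UN') (auto simp: \<F>_def null_sets_def sets)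
  moreover have "- measure_support M = \<Union>\<F>"
    by (auto simp: measure_support_def \<F>_def)
  ultimately show ?thesis using F'(3) by auto
qed

theorem lemma1:
  shows "\<exists>c::real. c > 0 \<and>
    (\<forall>(R::real) (\<mu> :: (real ^ 'n) measure) (f :: real ^ 'n \<Rightarrow> real).
       R > 0 \<longrightarrow>
       sets \<mu> = sets borel \<longrightarrow>
       compact (measure_support \<mu>) \<longrightarrow>
       measure_support \<mu> \<subseteq> {x. norm x \<le> R} \<longrightarrow>
       absolutely_continuous lborel \<mu> \<longrightarrow>
       (\<forall>A \<in> sets borel. emeasure \<mu> A \<le> emeasure lborel A) \<longrightarrow>
       (\<exists>L. L-lipschitz_on UNIV f) \<longrightarrow>
       f 0 = 0 \<longrightarrow>
       ennreal \<bar>\<integral>x. f x \<partial>\<mu>\<bar> \<le>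
         ennreal (c * R * measure \<mu> UNIV powr ((real CARD('n) - 1) / real CARD('n)))
         * lorentz_d1_norm {x. norm x \<le> R} (grad f))"
proof (intro exI[of _ 2] conjI allI impI)
  fix R :: real and \<mu> :: "(real ^ 'n) measure" and f :: "real ^ 'n \<Rightarrow> real"
  assume R: "R > 0" and sets: "sets \<mu> = sets borel"
    and supp: "measure_support \<mu> \<subseteq> {x. norm x \<le> R}"
    and ac: "absolutely_continuous lborel \<mu>"
    and le: "\<forall>A \<in> sets borel. emeasure \<mu> A \<le> emeasure lborel A"
    and lip: "\<exists>L. L-lipschitz_on UNIV f" and f0: "f 0 = 0"
  have ball: "{x :: real ^ 'n. norm x \<le> R} = cball 0 R" by auto
  have "emeasure \<mu> (- cball 0 R) \<le> emeasure \<mu> (- measure_support \<mu>)"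
  proof (rule emeasure_mono)
    have "measure_support \<mu> = - \<Union>{U. open U \<and> emeasure \<mu> U = 0}"
      by (auto simp: measure_support_def)
    then have "closed (measure_support \<mu>)" by (auto intro!: closed_Compl open_Union)
    then show "- measure_support \<mu> \<in> sets \<mu>" by (auto simp: sets)
  qed (use supp in auto)
  then have outside: "emeasure \<mu> (- cball 0 R) = 0"
    using emeasure_compl_measure_support[OF sets] by simp
  interpret ball_supported_measure \<mu> R
    by standard (use R sets le outside in auto)
  obtain L where L: "L-lipschitz_on UNIV f" using lip by blast
  show "ennreal \<bar>\<integral>x. f x \<partial>\<mu>\<bar> \<le>
         ennreal (2 * R * measure \<mu> UNIV powr ((real CARD('n) - 1) / real CARD('n)))
         * lorentz_d1_norm {x. norm x \<le> R} (grad f)"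
    using abs_integral_le_lorentz[OF ac L f0] by (simp add: ball)
qed simp

end
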